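(* Let $\rho$ be a two-qubit density matrix in the set $\mathcal{S}$, i.e. $$\rho=\tfrac12\big(|ab\rangle\langle ab|+e^{-\imath\alpha}R^{\dagger}|ab\rangle\langle a'b'|+e^{\imath\alpha}R\,|a'b'\rangle\langle ab|+|a'b'\rangle\langle a'b'|\big),$$ where $\{|a\rangle,|a'\rangle\}$ and $\{|b\rangle,|b'\rangle\}$ are orthonormal bases of $\mathbb{C}^2$, $\alpha\in[0,2\pi)$, and $R\in\mathbb{C}$ with $|R|\in[0,1]$. Assume $|R|>0$ and put $F=\frac12(1+|R|)$. Then the maximal success probability over all LOCC distillation operations that achieve the optimal fidelity, $$P^*(\rho)=\max\{P_{\mathcal{D}}(\rho)\;:\;\mathcal{D}\text{ an LOCC distillation operation with }F_{\mathcal{D}}(\rho)=F^*(\rho)\},$$ is $$P^*(\rho)=F^2+(1-F)^2.$$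
   Context: Notation: $\dagger$ denotes Hermitian transpose (complex conjugation for scalars), $\imath$ is the imaginary unit, $\{|0\rangle,|1\rangle\}$ is the computational basis of $\mathbb{C}^2$, $|\Phi^+\rangle=\frac1{\sqrt2}(|00\rangle+|11\rangle)$, and $|xy\rangle=|x\rangle\otimes|y\rangle$ with the first factor held by node Alice and the second by node Bob. One round of distillation: Alice and Bob hold two qubit pairs, each in state $\rho$, with joint state $\rho^{\mathrm J}=\rho\otimes\rho$. The first pair consists of qubits 1 and 2 and the second pair of qubits 3 and 4; Alice holds qubits 1 and 3, Bob holds qubits 2 and 4. A distillation operation $\mathcal{D}$ is a quantum operation (completely positive, trace-non-increasing map) on the four qubits, describing the "success" outcome, that is implementable by local operations and classical communication (LOCC) between Alice and Bob. The first pair is kept upon success. The success probability is $P_{\mathcal{D}}(\rho)=\mathrm{tr}\{\mathcal{D}\{\rho^{\mathrm J}\}\}$, and (when this is nonzero) the density matrix of the kept pair is $$\rho_{\mathrm{out}}=\frac{\mathrm{tr}_{3,4}\{\mathcal{D}\{\rho^{\mathrm J}\}\}}{\mathrm{tr}\{\mathcal{D}\{\rho^{\mathrm J}\}\}},$$ where $\mathrm{tr}_{3,4}$ is the partial trace over qubits 3 and 4. The fidelity of the kept pair is $F_{\mathcal{D}}(\rho)=\langle\Phi^+|\rho_{\mathrm{out}}|\Phi^+\rangle$. The optimal fidelity is $F^*(\rho)=\max_{\mathcal{D}}F_{\mathcal{D}}(\rho)$, the maximum being over all such $\mathcal{D}$ with nonzero success probability. *)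

theory Defs
  imports Complex_Main "Jordan_Normal_Form.Schur_Decomposition"
begin

section \<open>Finite-dimensional quantum states\<close>

text \<open>
  Operators are complex matrices in the computational basis. In a tensor product the left
  factor carries the more significant part of the index, so for qubits $1,\dots,n$ the index
  of $|x_1 \dots x_n\rangle$ has binary digits $x_1 \dots x_n$, most significant first.
  Note that \<open>v \<bullet>c w\<close> is conjugate-linear in its second argument, that is
  $\langle w | v \rangle$ in Dirac notation.
\<close>

definition tensor_vec :: "complex vec \<Rightarrow> complex vec \<Rightarrow> complex vec" where
  "tensor_vec u v =
     vec (dim_vec u * dim_vec v) (\<lambda>i. u $ (i div dim_vec v) * v $ (i mod dim_vec v))"

definition tensor_mat :: "complex mat \<Rightarrow> complex mat \<Rightarrow> complex mat" where
  "tensor_mat A B =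
     mat (dim_row A * dim_row B) (dim_col A * dim_col B)
       (\<lambda>(i, j). A $$ (i div dim_row B, j div dim_col B) * B $$ (i mod dim_row B, j mod dim_col B))"

definition ketbra :: "complex vec \<Rightarrow> complex vec \<Rightarrow> complex mat" where
  "ketbra u v = mat (dim_vec u) (dim_vec v) (\<lambda>(i, j). u $ i * cnj (v $ j))"

definition mat_trace :: "complex mat \<Rightarrow> complex" where
  "mat_trace A = (\<Sum>i<dim_row A. A $$ (i, i))"

definition partial_trace_right :: "nat \<Rightarrow> nat \<Rightarrow> complex mat \<Rightarrow> complex mat" where
  "partial_trace_right m n X = mat m m (\<lambda>(i, j). \<Sum>k<n. X $$ (i * n + k, j * n + k))"

text \<open>The matrices of a given size form a monoid only relative to that size, so finite sums
  of square matrices are taken entrywise.\<close>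

definition mat_sum :: "nat \<Rightarrow> nat \<Rightarrow> (nat \<Rightarrow> complex mat) \<Rightarrow> complex mat" where
  "mat_sum n k M = mat n n (\<lambda>(i, j). \<Sum>l<k. M l $$ (i, j))"

definition density_matrix :: "nat \<Rightarrow> complex mat \<Rightarrow> bool" where
  "density_matrix n \<rho> \<longleftrightarrow>
     \<rho> \<in> carrier_mat n n \<and> mat_adjoint \<rho> = \<rho> \<and>
     (\<forall>v \<in> carrier_vec n. 0 \<le> Re ((\<rho> *\<^sub>v v) \<bullet>c v)) \<and> mat_trace \<rho> = 1"

text \<open>Two orthonormal vectors of $\mathbb{C}^2$ automatically span it.\<close>

definition qubit_onb :: "complex vec \<Rightarrow> complex vec \<Rightarrow> bool" where
  "qubit_onb u u' \<longleftrightarrow>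
     u \<in> carrier_vec 2 \<and> u' \<in> carrier_vec 2 \<and> u \<bullet>c u = 1 \<and> u' \<bullet>c u' = 1 \<and> u \<bullet>c u' = 0"

definition ket0 :: "complex vec" where "ket0 = unit_vec 2 0"
definition ket1 :: "complex vec" where "ket1 = unit_vec 2 1"

definition Phi_plus :: "complex vec" where
  "Phi_plus = complex_of_real (1 / sqrt 2) \<cdot>\<^sub>v (tensor_vec ket0 ket0 + tensor_vec ket1 ket1)"

definition S_state ::
    "complex vec \<Rightarrow> complex vec \<Rightarrow> complex vec \<Rightarrow> complex vec \<Rightarrow> real \<Rightarrow> complex \<Rightarrow> complex mat" where
  "S_state a a' b b' \<alpha> R =
     (let ab = tensor_vec a b; ab' = tensor_vec a' b' in
      (1 / 2) \<cdot>\<^sub>m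
       (ketbra ab ab
        + (exp (- \<i> * complex_of_real \<alpha>) * cnj R) \<cdot>\<^sub>m ketbra ab ab'
        + (exp (\<i> * complex_of_real \<alpha>) * R) \<cdot>\<^sub>m ketbra ab' ab
        + ketbra ab' ab'))"


section \<open>LOCC operations\<close>

text \<open>
  \<open>locc p q m n D\<close>: the map \<open>D\<close>, from operators on $\mathbb{C}^m \otimes \mathbb{C}^n$ to
  operators on $\mathbb{C}^p \otimes \mathbb{C}^q$ (first factor Alice, second factor Bob), is
  the success branch of a finite-round LOCC protocol. In each round one party applies a
  measurement given by Kraus operators $K_0, \dots, K_{k-1}$ with
  $\sum_i K_i^\dagger K_i = 1$ to its own system and announces the outcome \<open>i\<close>, on
  which the rest of the protocol may depend; eventually the parties declare success or failure,
  and success branches are summed. A Kraus operator may change the dimension of the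
  local system, so that ancillas of any size can be attached, kept over several rounds and
  discarded. An outcome that is forgotten, or seen by one party only, is the special case
  in which the remaining protocol ignores it. All these maps are completely positive and
  trace-non-increasing by construction.
\<close>

inductive locc :: "nat \<Rightarrow> nat \<Rightarrow> nat \<Rightarrow> nat \<Rightarrow> (complex mat \<Rightarrow> complex mat) \<Rightarrow> bool"
  for p q :: nat where
  success: "locc p q p q (\<lambda>X. X)"
| failure: "locc p q m n (\<lambda>X. 0\<^sub>m (p * q) (p * q))"
| alice:
    "(\<And>i. i < k \<Longrightarrow> K i \<in> carrier_mat (d i) m) \<Longrightarrow>
     mat_sum m k (\<lambda>i. mat_adjoint (K i) * K i) = 1\<^sub>m m \<Longrightarrow>
     (\<And>i. i < k \<Longrightarrow> locc p q (d i) n (D i)) \<Longrightarrow>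
     locc p q m n
       (\<lambda>X. mat_sum (p * q) k
          (\<lambda>i. D i (tensor_mat (K i) (1\<^sub>m n) * X * mat_adjoint (tensor_mat (K i) (1\<^sub>m n)))))"
| bob:
    "(\<And>i. i < k \<Longrightarrow> K i \<in> carrier_mat (d i) n) \<Longrightarrow>
     mat_sum n k (\<lambda>i. mat_adjoint (K i) * K i) = 1\<^sub>m n \<Longrightarrow>
     (\<And>i. i < k \<Longrightarrow> locc p q m (d i) (D i)) \<Longrightarrow>
     locc p q m n
       (\<lambda>X. mat_sum (p * q) k
          (\<lambda>i. D i (tensor_mat (1\<^sub>m m) (K i) * X * mat_adjoint (tensor_mat (1\<^sub>m m) (K i)))))"


section \<open>One round of distillation\<close>

text \<open>
  The joint state $\rho \otimes \rho$ lives on the qubits in the order 1, 2, 3, 4, whereas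
  Alice holds 1 and 3 and Bob holds 2 and 4. Exchanging qubits 2 and 3 turns the former order
  into the bipartition Alice--Bob, and back.
\<close>

definition swap23_index :: "nat \<Rightarrow> nat" where
  "swap23_index i = 8 * (i div 8) + 4 * (i div 2 mod 2) + 2 * (i div 4 mod 2) + i mod 2"

definition swap23 :: "complex mat \<Rightarrow> complex mat" where
  "swap23 X = mat 16 16 (\<lambda>(i, j). X $$ (swap23_index i, swap23_index j))"

definition distillation_ops :: "(complex mat \<Rightarrow> complex mat) set" where
  "distillation_ops = {(\<lambda>X. swap23 (L (swap23 X))) | L. locc 4 4 4 4 L}"

definition joint_state :: "complex mat \<Rightarrow> complex mat" where
  "joint_state \<rho> = tensor_mat \<rho> \<rho>"

text \<open>The traces and expectation values below are real for density matrices; the real part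
  only adjusts the type.\<close>

definition success_prob :: "(complex mat \<Rightarrow> complex mat) \<Rightarrow> complex mat \<Rightarrow> real" where
  "success_prob D \<rho> = Re (mat_trace (D (joint_state \<rho>)))"

definition output_state :: "(complex mat \<Rightarrow> complex mat) \<Rightarrow> complex mat \<Rightarrow> complex mat" where
  "output_state D \<rho> =
     (1 / mat_trace (D (joint_state \<rho>))) \<cdot>\<^sub>m partial_trace_right 4 4 (D (joint_state \<rho>))"

definition fidelity :: "(complex mat \<Rightarrow> complex mat) \<Rightarrow> complex mat \<Rightarrow> real" where
  "fidelity D \<rho> = Re ((output_state D \<rho> *\<^sub>v Phi_plus) \<bullet>c Phi_plus)"

definition is_maximum :: "real set \<Rightarrow> real \<Rightarrow> bool" where
  "is_maximum A x \<longleftrightarrow> x \<in> A \<and> (\<forall>y \<in> A. y \<le> x)"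

definition achievable_fidelities :: "complex mat \<Rightarrow> real set" where
  "achievable_fidelities \<rho> =
     {fidelity D \<rho> | D. D \<in> distillation_ops \<and> success_prob D \<rho> \<noteq> 0}"

text \<open>\<open>GREATEST\<close> is meaningful only if the maximum is attained, which has to be
  established separately.\<close>

definition opt_fidelity :: "complex mat \<Rightarrow> real" where
  "opt_fidelity \<rho> = (GREATEST f. f \<in> achievable_fidelities \<rho>)"

definition opt_success_probs :: "complex mat \<Rightarrow> real set" where
  "opt_success_probs \<rho> =
     {success_prob D \<rho> | D.
        D \<in> distillation_ops \<and> success_prob D \<rho> \<noteq> 0 \<and> fidelity D \<rho> = opt_fidelity \<rho>}"

definition opt_success_prob :: "complex mat \<Rightarrow> real" where
  "opt_success_prob \<rho> = (GREATEST P. P \<in> opt_success_probs \<rho>)"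

end

theory Submission
  imports Defs
begin

text \<open>
  Absorbing the phase of $R$ into $a'$ turns $\rho$ into the mixture, with weights $F$ and
  $1 - F$, of the even and the odd superposition of $|ab\rangle$ and $|a'b'\rangle$. Two copies
  are a mixture of four orthogonal states, with weights $F^2$, $F(1-F)$, $F(1-F)$, $(1-F)^2$.
  For a success branch of an LOCC protocol let $\tau_s$ be the trace of the output on the
  $s$-th of these states and $\phi_s$ its overlap with $\Phi^+$, so that $\phi_s \le \tau_s$.
  The uniform mixture of the four states is also a mixture of four product states, on which
  the output stays separable and has overlap at most half of its trace, so
  $2 \sum_s \phi_s \le \sum_s \tau_s$. With $p = \sum_s \lambda_s \tau_s$ and
  $f = \sum_s \lambda_s \phi_s$ this yields
  $(1-F)^2 f \le (1-F)^2 F^2 \sum_s \phi_s \le F^2 (p - f)$, the bound on the fidelity $f / p$.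
  If it is attained, only the error-free state contributes to $f$, whence $f \le F^2$, which
  bounds $p$. Both bounds are attained when each party measures the product of its two
  Pauli X operators and the pair is kept if the outcomes agree.
\<close>

section \<open>Matrices and tensor products\<close>

text \<open>About a protocol only the inductive generation of its map is known, and a Kraus form of
  the whole branch is never built. Each property used for optimality is therefore an induction over
  \<open>locc\<close>: linearity on finite weighted sums (\<open>locc_mat_sum\<close>), bounds on
  rank-one inputs (\<open>locc_ketbra_bounds\<close>) and the separability bound on product inputs
  (\<open>locc_product_bound\<close>). Rank-one inputs suffice because conjugation by an operator
  keeps them rank-one.

  The factor one half is the largest squared overlap of a product unit vector with Phi+. It can be
  used because the Hadamard transform that leads from the product states to their superpositions is
  unitary, so both families add up to the same projector. The true weights are compared with uniform
  ones only through their extremes, the least being (1 - F)^2 and the largest F^2; hence the optimal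
  fidelity is F^2 / (F^2 + (1 - F)^2). The condition |R| > 0 makes F exceed 1/2, so that the largest
  weight is strictly largest, as the case of equality requires.\<close>

lemma mat_adjoint_dim [simp]:
  "dim_row (mat_adjoint A) = dim_col A" "dim_col (mat_adjoint A) = dim_row A"
  by (simp_all add: mat_adjoint_def)

lemma mat_adjoint_index [simp]:
  fixes A :: "complex mat"
  assumes "i < dim_col A" "j < dim_row A"
  shows "mat_adjoint A $$ (i, j) = cnj (A $$ (j, i))"
  using assms by (simp add: mat_adjoint_def mat_of_rows_index conjugate_complex_def)

lemma mat_sum_carrier [simp]: "mat_sum n k M \<in> carrier_mat n n"
  by (simp add: mat_sum_def)

lemma mat_sum_dim [simp]: "dim_row (mat_sum n k M) = n" "dim_col (mat_sum n k M) = n"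
  by (simp_all add: mat_sum_def)

lemma mat_sum_index [simp]:
  "i < n \<Longrightarrow> j < n \<Longrightarrow> mat_sum n k M $$ (i, j) = (\<Sum>l<k. M l $$ (i, j))"
  by (simp add: mat_sum_def)

lemma mat_sum_cong:
  "(\<And>i. i < k \<Longrightarrow> M i = N i) \<Longrightarrow> mat_sum n k M = mat_sum n k N"
  by (simp add: mat_sum_def)

lemma ketbra_dim [simp]: "dim_row (ketbra u v) = dim_vec u" "dim_col (ketbra u v) = dim_vec v"
  by (simp_all add: ketbra_def)

lemma ketbra_index [simp]:
  "i < dim_vec u \<Longrightarrow> j < dim_vec v \<Longrightarrow> ketbra u v $$ (i, j) = u $ i * cnj (v $ j)"
  by (simp add: ketbra_def)

lemma ketbra_carrier [simp]:
  "u \<in> carrier_vec m \<Longrightarrow> v \<in> carrier_vec n \<Longrightarrow> ketbra u v \<in> carrier_mat m n"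
  by (simp add: ketbra_def)

lemma tensor_vec_dim [simp]: "dim_vec (tensor_vec u v) = dim_vec u * dim_vec v"
  by (simp add: tensor_vec_def)

lemma tensor_vec_carrier [simp]:
  "u \<in> carrier_vec m \<Longrightarrow> v \<in> carrier_vec n \<Longrightarrow> tensor_vec u v \<in> carrier_vec (m * n)"
  by (simp add: tensor_vec_def)

lemma tensor_vec_index [simp]:
  "i < dim_vec u * dim_vec v \<Longrightarrow>
     tensor_vec u v $ i = u $ (i div dim_vec v) * v $ (i mod dim_vec v)"
  by (simp add: tensor_vec_def)

lemma tensor_mat_dim [simp]:
  "dim_row (tensor_mat A B) = dim_row A * dim_row B"
  "dim_col (tensor_mat A B) = dim_col A * dim_col B"
  by (simp_all add: tensor_mat_def)

lemma tensor_mat_carrier [simp]: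
  "A \<in> carrier_mat p m \<Longrightarrow> B \<in> carrier_mat q n \<Longrightarrow> tensor_mat A B \<in> carrier_mat (p * q) (m * n)"
  by (simp add: tensor_mat_def)

lemma tensor_mat_index [simp]:
  "i < dim_row A * dim_row B \<Longrightarrow> j < dim_col A * dim_col B \<Longrightarrow>
     tensor_mat A B $$ (i, j) =
       A $$ (i div dim_row B, j div dim_col B) * B $$ (i mod dim_row B, j mod dim_col B)"
  by (simp add: tensor_mat_def)

lemma div_mod_less:
  fixes i m n :: nat
  assumes "i < m * n"
  shows "i div n < m" "i mod n < n"
  using assms by (auto simp: less_mult_imp_div_less intro!: mod_less_divisor gr0I)

text \<open>Splitting an index into quotient and remainder is the convention of
  \<open>tensor_vec\<close> and \<open>tensor_mat\<close>, so this turns a sum over a product space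
  into a double sum over its factors.\<close>

lemma sum_lessThan_mult:
  fixes f :: "nat \<Rightarrow> nat \<Rightarrow> 'a::comm_monoid_add"
  shows "(\<Sum>i<m * n. f (i div n) (i mod n)) = (\<Sum>x<m. \<Sum>y<n. f x y)"
proof -
  have "(\<Sum>i<m * n. f (i div n) (i mod n)) = (\<Sum>x<m. \<Sum>i\<in>{x * n..<x * n + n}. f (i div n) (i mod n))"
    by (rule sum.nat_group [symmetric])
  also have "\<dots> = (\<Sum>x<m. \<Sum>y<n. f x y)"
  proof (rule sum.cong [OF refl])
    fix x
    have "(\<Sum>i\<in>{x * n..<x * n + n}. f (i div n) (i mod n))
        = (\<Sum>y\<in>{0..<n}. f ((y + x * n) div n) ((y + x * n) mod n))"
      using sum.shift_bounds_nat_ivl [of "\<lambda>i. f (i div n) (i mod n)" 0 "x * n" n]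
      by (simp add: add.commute)
    also have "\<dots> = (\<Sum>y<n. f x y)"
      by (rule sum.cong) auto
    finally show "(\<Sum>i\<in>{x * n..<x * n + n}. f (i div n) (i mod n)) = (\<Sum>y<n. f x y)" .
  qed
  finally show ?thesis .
qed

section \<open>Entrywise formulas for products, norms and traces\<close>

lemma mult_mat_vec_index:
  "i < dim_row A \<Longrightarrow> dim_vec v = dim_col A \<Longrightarrow> (A *\<^sub>v v) $ i = (\<Sum>k<dim_col A. A $$ (i, k) * v $ k)"
  by (simp add: scalar_prod_def atLeast0LessThan)

lemma mult_mat_index:
  "i < dim_row A \<Longrightarrow> j < dim_col B \<Longrightarrow> dim_row B = dim_col A \<Longrightarrow>
     (A * B) $$ (i, j) = (\<Sum>k<dim_col A. A $$ (i, k) * B $$ (k, j))"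
  by (simp add: scalar_prod_def atLeast0LessThan)

lemma cscalar_prod_sum:
  fixes u v :: "complex vec"
  shows "u \<bullet>c v = (\<Sum>i<dim_vec v. u $ i * cnj (v $ i))"
  by (simp add: scalar_prod_def atLeast0LessThan conjugate_complex_def)

lemma cscalar_prod_self:
  fixes v :: "complex vec"
  shows "v \<bullet>c v = complex_of_real (\<Sum>i<dim_vec v. (cmod (v $ i))\<^sup>2)"
  unfolding cscalar_prod_sum of_real_sum complex_norm_square ..

lemma cscalar_prod_tensor:
  assumes "dim_vec u = dim_vec u'" "dim_vec v = dim_vec v'"
  shows "tensor_vec u v \<bullet>c tensor_vec u' v' = (u \<bullet>c u') * (v \<bullet>c v')"
proof -
  have "tensor_vec u v \<bullet>c tensor_vec u' v'
      = (\<Sum>i<dim_vec u' * dim_vec v'.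
          (\<lambda>x y. (u $ x * cnj (u' $ x)) * (v $ y * cnj (v' $ y))) (i div dim_vec v') (i mod dim_vec v'))"
    unfolding cscalar_prod_sum by (rule sum.cong) (auto simp: assms)
  also have "\<dots> = (\<Sum>x<dim_vec u'. \<Sum>y<dim_vec v'. (u $ x * cnj (u' $ x)) * (v $ y * cnj (v' $ y)))"
    by (rule sum_lessThan_mult)
  finally show ?thesis
    by (simp add: cscalar_prod_sum sum_product)
qed

lemma mat_trace_ketbra: "mat_trace (ketbra v v) = v \<bullet>c v"
  by (simp add: mat_trace_def cscalar_prod_sum)

lemma mat_trace_mat_sum:
  assumes "\<And>l. l < k \<Longrightarrow> M l \<in> carrier_mat n n"
  shows "mat_trace (mat_sum n k M) = (\<Sum>l<k. mat_trace (M l))"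
proof -
  have "dim_row (M l) = n" if "l < k" for l
    using assms [OF that] by simp
  then show ?thesis
    unfolding mat_trace_def by simp (rule sum.swap)
qed

lemma mat_trace_smult: "A \<in> carrier_mat n n \<Longrightarrow> mat_trace (c \<cdot>\<^sub>m A) = c * mat_trace A"
  by (auto simp: mat_trace_def sum_distrib_left)

lemma mult_ketbra:
  assumes "T \<in> carrier_mat p q" "v \<in> carrier_vec q"
  shows "T * ketbra v v * mat_adjoint T = ketbra (T *\<^sub>v v) (T *\<^sub>v v)"
  using assms
  by (intro eq_matI)
     (auto simp: mult_mat_index mult_mat_vec_index sum_distrib_left sum_distrib_right mult_ac
       simp del: index_mult_mat(1) index_mult_mat_vec)

lemma mult_mat_sum:
  assumes T: "T \<in> carrier_mat p q" and X: "\<And>l. l < k \<Longrightarrow> X l \<in> carrier_mat q q"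
  shows "T * mat_sum q k (\<lambda>l. c l \<cdot>\<^sub>m X l) * mat_adjoint T
       = mat_sum p k (\<lambda>l. c l \<cdot>\<^sub>m (T * X l * mat_adjoint T))"
proof (rule eq_matI)
  fix i j
  assume "i < dim_row (mat_sum p k (\<lambda>l. c l \<cdot>\<^sub>m (T * X l * mat_adjoint T)))"
    and "j < dim_col (mat_sum p k (\<lambda>l. c l \<cdot>\<^sub>m (T * X l * mat_adjoint T)))"
  then have ij: "i < p" "j < p" by auto
  have X': "dim_row (X l) = q" "dim_col (X l) = q" if "l < k" for l
    using X [OF that] by auto
  have "(T * mat_sum q k (\<lambda>l. c l \<cdot>\<^sub>m X l) * mat_adjoint T) $$ (i, j)
      = (\<Sum>y<q. \<Sum>x<q. \<Sum>l<k. c l * T $$ (i, x) * X l $$ (x, y) * cnj (T $$ (j, y)))"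
    using T X' ij
    by (auto simp: mult_mat_index sum_distrib_left sum_distrib_right mult_ac carrier_matD
         simp del: index_mult_mat(1) intro!: sum.cong)
  also have "\<dots> = (\<Sum>l<k. \<Sum>y<q. \<Sum>x<q. c l * T $$ (i, x) * X l $$ (x, y) * cnj (T $$ (j, y)))"
    by (subst sum.swap, rule sum.cong [OF refl], subst sum.swap, rule refl)
  also have "\<dots> = (\<Sum>l<k. (c l \<cdot>\<^sub>m (T * X l * mat_adjoint T)) $$ (i, j))"
    using T X' ij
    by (intro sum.cong refl)
       (auto simp: mult_mat_index sum_distrib_left sum_distrib_right mult_ac carrier_matD
         simp del: index_mult_mat(1) intro!: sum.cong)
  finally show "(T * mat_sum q k (\<lambda>l. c l \<cdot>\<^sub>m X l) * mat_adjoint T) $$ (i, j)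
      = mat_sum p k (\<lambda>l. c l \<cdot>\<^sub>m (T * X l * mat_adjoint T)) $$ (i, j)"
    using ij by simp
qed (use T in auto)

lemma tensor_mat_mult_vec:
  assumes "A \<in> carrier_mat p m" "B \<in> carrier_mat q n" "u \<in> carrier_vec m" "v \<in> carrier_vec n"
  shows "tensor_mat A B *\<^sub>v tensor_vec u v = tensor_vec (A *\<^sub>v u) (B *\<^sub>v v)"
proof (rule eq_vecI)
  fix i
  assume "i < dim_vec (tensor_vec (A *\<^sub>v u) (B *\<^sub>v v))"
  then have i: "i < p * q" using assms by simp
  note i' = div_mod_less [OF i]
  have "(tensor_mat A B *\<^sub>v tensor_vec u v) $ i
      = (\<Sum>k<m * n. (\<lambda>x y. (A $$ (i div q, x) * u $ x) * (B $$ (i mod q, y) * v $ y)) (k div n) (k mod n))"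
    using assms i
    by (auto simp: mult_mat_vec_index carrier_matD carrier_vecD simp del: index_mult_mat_vec intro!: sum.cong)
  also have "\<dots> = (\<Sum>x<m. \<Sum>y<n. (A $$ (i div q, x) * u $ x) * (B $$ (i mod q, y) * v $ y))"
    by (rule sum_lessThan_mult)
  also have "\<dots> = tensor_vec (A *\<^sub>v u) (B *\<^sub>v v) $ i"
    using assms i i'
    by (auto simp: mult_mat_vec_index carrier_matD carrier_vecD sum_product simp del: index_mult_mat_vec)
  finally show "(tensor_mat A B *\<^sub>v tensor_vec u v) $ i = tensor_vec (A *\<^sub>v u) (B *\<^sub>v v) $ i" .
qed (use assms in auto)

text \<open>With \<open>v\<close> read as an \<open>m\<close> by \<open>n\<close> array of
  coefficients, left slices are its columns and right slices its rows: the unnormalised state of one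
  party when the other is found in a fixed basis state.\<close>

definition left_slice :: "nat \<Rightarrow> nat \<Rightarrow> complex vec \<Rightarrow> nat \<Rightarrow> complex vec" where
  "left_slice m n v y = vec m (\<lambda>x. v $ (x * n + y))"

definition right_slice :: "nat \<Rightarrow> complex vec \<Rightarrow> nat \<Rightarrow> complex vec" where
  "right_slice n v x = vec n (\<lambda>y. v $ (x * n + y))"

text \<open>An operator of Alice alone acts on every column separately, which reduces statements
  about tensored operators to statements about one factor.\<close>

lemma tensor_one_right_index:
  assumes K: "K \<in> carrier_mat d m" and v: "v \<in> carrier_vec (m * n)" and i: "i < d * n"
  shows "(tensor_mat K (1\<^sub>m n) *\<^sub>v v) $ i = (K *\<^sub>v left_slice m n v (i mod n)) $ (i div n)"
proof -
  note i' = div_mod_less [OF i]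
  have "(tensor_mat K (1\<^sub>m n) *\<^sub>v v) $ i
      = (\<Sum>k<m * n. (\<lambda>x y. K $$ (i div n, x) * (if i mod n = y then v $ (x * n + y) else 0))
          (k div n) (k mod n))"
    using K v i i'
    by (subst mult_mat_vec_index) (auto simp: carrier_matD carrier_vecD div_mod_less intro!: sum.cong)
  also have "\<dots> = (\<Sum>x<m. \<Sum>y<n. K $$ (i div n, x) * (if i mod n = y then v $ (x * n + y) else 0))"
    by (rule sum_lessThan_mult)
  also have "\<dots> = (\<Sum>x<m. K $$ (i div n, x) * v $ (x * n + i mod n))"
    using i' by (intro sum.cong refl) (simp add: if_distrib sum.delta cong: if_cong)
  also have "\<dots> = (K *\<^sub>v left_slice m n v (i mod n)) $ (i div n)"
    using K i' by (subst mult_mat_vec_index) (auto simp: left_slice_def carrier_matD)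
  finally show ?thesis .
qed

lemma tensor_one_left_index:
  assumes K: "K \<in> carrier_mat d n" and v: "v \<in> carrier_vec (m * n)" and i: "i < m * d"
  shows "(tensor_mat (1\<^sub>m m) K *\<^sub>v v) $ i = (K *\<^sub>v right_slice n v (i div d)) $ (i mod d)"
proof -
  note i' = div_mod_less [OF i]
  have "(tensor_mat (1\<^sub>m m) K *\<^sub>v v) $ i
      = (\<Sum>k<m * n. (\<lambda>x y. (if i div d = x then K $$ (i mod d, y) * v $ (x * n + y) else 0))
          (k div n) (k mod n))"
    using K v i i'
    by (subst mult_mat_vec_index) (auto simp: carrier_matD carrier_vecD div_mod_less intro!: sum.cong)
  also have "\<dots> = (\<Sum>x<m. \<Sum>y<n. (if i div d = x then K $$ (i mod d, y) * v $ (x * n + y) else 0))"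
    by (rule sum_lessThan_mult)
  also have "\<dots> = (\<Sum>x<m. if i div d = x then \<Sum>y<n. K $$ (i mod d, y) * v $ (x * n + y) else 0)"
    by (intro sum.cong refl) auto
  also have "\<dots> = (\<Sum>y<n. K $$ (i mod d, y) * v $ (i div d * n + y))"
    using i' by (simp add: sum.delta)
  also have "\<dots> = (K *\<^sub>v right_slice n v (i div d)) $ (i mod d)"
    using K i' by (subst mult_mat_vec_index) (auto simp: right_slice_def carrier_matD)
  finally show ?thesis .
qed

lemma norm_left_slices:
  assumes "v \<in> carrier_vec (m * n)"
  shows "v \<bullet>c v = (\<Sum>y<n. left_slice m n v y \<bullet>c left_slice m n v y)"
proof -
  have "v \<bullet>c v = (\<Sum>i<m * n. (\<lambda>x y. v $ (x * n + y) * cnj (v $ (x * n + y))) (i div n) (i mod n))"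
    using assms by (simp add: cscalar_prod_sum carrier_vecD)
  also have "\<dots> = (\<Sum>x<m. \<Sum>y<n. v $ (x * n + y) * cnj (v $ (x * n + y)))"
    by (rule sum_lessThan_mult)
  also have "\<dots> = (\<Sum>y<n. \<Sum>x<m. v $ (x * n + y) * cnj (v $ (x * n + y)))"
    by (rule sum.swap)
  finally show ?thesis
    by (simp add: cscalar_prod_sum left_slice_def)
qed

lemma norm_right_slices:
  assumes "v \<in> carrier_vec (m * n)"
  shows "v \<bullet>c v = (\<Sum>x<m. right_slice n v x \<bullet>c right_slice n v x)"
proof -
  have "v \<bullet>c v = (\<Sum>i<m * n. (\<lambda>x y. v $ (x * n + y) * cnj (v $ (x * n + y))) (i div n) (i mod n))"
    using assms by (simp add: cscalar_prod_sum carrier_vecD)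
  also have "\<dots> = (\<Sum>x<m. \<Sum>y<n. v $ (x * n + y) * cnj (v $ (x * n + y)))"
    by (rule sum_lessThan_mult)
  finally show ?thesis
    by (simp add: cscalar_prod_sum right_slice_def)
qed

lemma norm_tensor_one_right:
  assumes K: "K \<in> carrier_mat d m" and v: "v \<in> carrier_vec (m * n)"
  defines "w \<equiv> tensor_mat K (1\<^sub>m n) *\<^sub>v v"
  shows "w \<bullet>c w = (\<Sum>y<n. (K *\<^sub>v left_slice m n v y) \<bullet>c (K *\<^sub>v left_slice m n v y))"
proof -
  let ?u = "\<lambda>y. K *\<^sub>v left_slice m n v y"
  have "w \<bullet>c w = (\<Sum>i<d * n. (\<lambda>x y. ?u y $ x * cnj (?u y $ x)) (i div n) (i mod n))"
    unfolding cscalar_prod_sum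
    using K v by (intro sum.cong) (auto simp: w_def tensor_one_right_index simp del: index_mult_mat_vec)
  also have "\<dots> = (\<Sum>x<d. \<Sum>y<n. ?u y $ x * cnj (?u y $ x))"
    by (rule sum_lessThan_mult)
  also have "\<dots> = (\<Sum>y<n. \<Sum>x<d. ?u y $ x * cnj (?u y $ x))"
    by (rule sum.swap)
  finally show ?thesis
    using K by (simp add: cscalar_prod_sum carrier_matD del: index_mult_mat_vec)
qed

lemma norm_tensor_one_left:
  assumes K: "K \<in> carrier_mat d n" and v: "v \<in> carrier_vec (m * n)"
  defines "w \<equiv> tensor_mat (1\<^sub>m m) K *\<^sub>v v"
  shows "w \<bullet>c w = (\<Sum>x<m. (K *\<^sub>v right_slice n v x) \<bullet>c (K *\<^sub>v right_slice n v x))"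
proof -
  let ?u = "\<lambda>x. K *\<^sub>v right_slice n v x"
  have "w \<bullet>c w = (\<Sum>i<m * d. (\<lambda>x y. ?u x $ y * cnj (?u x $ y)) (i div d) (i mod d))"
    unfolding cscalar_prod_sum
    using K v by (intro sum.cong) (auto simp: w_def tensor_one_left_index simp del: index_mult_mat_vec)
  also have "\<dots> = (\<Sum>x<m. \<Sum>y<d. ?u x $ y * cnj (?u x $ y))"
    by (rule sum_lessThan_mult)
  finally show ?thesis
    using K by (simp add: cscalar_prod_sum carrier_matD del: index_mult_mat_vec)
qed

text \<open>The squared norms expand into the entries of the sum of all
  \<open>mat_adjoint (K i) * K i\<close>, contracted with \<open>v\<close>; by completeness this sum
  is the identity.\<close>

lemma kraus_norm:
  assumes K: "\<And>i. i < k \<Longrightarrow> K i \<in> carrier_mat (d i) m"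
    and one: "mat_sum m k (\<lambda>i. mat_adjoint (K i) * K i) = 1\<^sub>m m"
    and v: "v \<in> carrier_vec m"
  shows "(\<Sum>i<k. (K i *\<^sub>v v) \<bullet>c (K i *\<^sub>v v)) = v \<bullet>c v"
proof -
  have "(K i *\<^sub>v v) \<bullet>c (K i *\<^sub>v v)
      = (\<Sum>x<m. \<Sum>y<m. v $ x * cnj (v $ y) * (mat_adjoint (K i) * K i) $$ (y, x))" if "i < k" for i
  proof -
    have "(K i *\<^sub>v v) \<bullet>c (K i *\<^sub>v v)
        = (\<Sum>r<d i. \<Sum>x<m. \<Sum>y<m. v $ x * cnj (v $ y) * (cnj (K i $$ (r, y)) * K i $$ (r, x)))"
      unfolding cscalar_prod_sum
      using K [OF that] v
      by (auto simp: mult_mat_vec_index sum_product mult_ac simp del: index_mult_mat_vec intro!: sum.cong)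
    also have "\<dots> = (\<Sum>x<m. \<Sum>y<m. \<Sum>r<d i. v $ x * cnj (v $ y) * (cnj (K i $$ (r, y)) * K i $$ (r, x)))"
      by (subst sum.swap, rule sum.cong [OF refl], subst sum.swap, rule refl)
    finally show ?thesis
      using K [OF that]
      by (auto simp: mult_mat_index sum_distrib_left simp del: index_mult_mat(1) intro!: sum.cong)
  qed
  then have "(\<Sum>i<k. (K i *\<^sub>v v) \<bullet>c (K i *\<^sub>v v))
      = (\<Sum>i<k. \<Sum>x<m. \<Sum>y<m. v $ x * cnj (v $ y) * (mat_adjoint (K i) * K i) $$ (y, x))"
    by (intro sum.cong) auto
  also have "\<dots> = (\<Sum>x<m. \<Sum>y<m. v $ x * cnj (v $ y) * mat_sum m k (\<lambda>i. mat_adjoint (K i) * K i) $$ (y, x))"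
    by (subst sum.swap, rule sum.cong [OF refl], subst sum.swap)
       (auto simp: sum_distrib_left simp del: index_mult_mat(1) intro!: sum.cong)
  also have "\<dots> = v \<bullet>c v"
    using v by (simp add: one cscalar_prod_sum if_distrib sum.delta carrier_vecD cong: if_cong)
  finally show ?thesis .
qed

text \<open>Completeness is given for the local operators only. Applying \<open>kraus_norm\<close>
  slice by slice lifts it to the joint space without multiplying tensored matrices.\<close>

lemma kraus_norm_tensor_right:
  assumes "\<And>i. i < k \<Longrightarrow> K i \<in> carrier_mat (d i) m"
    and "mat_sum m k (\<lambda>i. mat_adjoint (K i) * K i) = 1\<^sub>m m"
    and "v \<in> carrier_vec (m * n)"
  shows "(\<Sum>i<k. (tensor_mat (K i) (1\<^sub>m n) *\<^sub>v v) \<bullet>c (tensor_mat (K i) (1\<^sub>m n) *\<^sub>v v)) = v \<bullet>c v"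
proof -
  have "(\<Sum>i<k. (tensor_mat (K i) (1\<^sub>m n) *\<^sub>v v) \<bullet>c (tensor_mat (K i) (1\<^sub>m n) *\<^sub>v v))
      = (\<Sum>i<k. \<Sum>y<n. (K i *\<^sub>v left_slice m n v y) \<bullet>c (K i *\<^sub>v left_slice m n v y))"
    using assms by (intro sum.cong refl norm_tensor_one_right) auto
  also have "\<dots> = (\<Sum>y<n. \<Sum>i<k. (K i *\<^sub>v left_slice m n v y) \<bullet>c (K i *\<^sub>v left_slice m n v y))"
    by (rule sum.swap)
  also have "\<dots> = (\<Sum>y<n. left_slice m n v y \<bullet>c left_slice m n v y)"
    using assms by (intro sum.cong refl kraus_norm) (auto simp: left_slice_def)
  finally show ?thesis
    using norm_left_slices [OF assms(3)] by simp
qed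

lemma kraus_norm_tensor_left:
  assumes "\<And>i. i < k \<Longrightarrow> K i \<in> carrier_mat (d i) n"
    and "mat_sum n k (\<lambda>i. mat_adjoint (K i) * K i) = 1\<^sub>m n"
    and "v \<in> carrier_vec (m * n)"
  shows "(\<Sum>i<k. (tensor_mat (1\<^sub>m m) (K i) *\<^sub>v v) \<bullet>c (tensor_mat (1\<^sub>m m) (K i) *\<^sub>v v)) = v \<bullet>c v"
proof -
  have "(\<Sum>i<k. (tensor_mat (1\<^sub>m m) (K i) *\<^sub>v v) \<bullet>c (tensor_mat (1\<^sub>m m) (K i) *\<^sub>v v))
      = (\<Sum>i<k. \<Sum>x<m. (K i *\<^sub>v right_slice n v x) \<bullet>c (K i *\<^sub>v right_slice n v x))"
    using assms by (intro sum.cong refl norm_tensor_one_left) auto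
  also have "\<dots> = (\<Sum>x<m. \<Sum>i<k. (K i *\<^sub>v right_slice n v x) \<bullet>c (K i *\<^sub>v right_slice n v x))"
    by (rule sum.swap)
  also have "\<dots> = (\<Sum>x<m. right_slice n v x \<bullet>c right_slice n v x)"
    using assms by (intro sum.cong refl kraus_norm) (auto simp: right_slice_def)
  finally show ?thesis
    using norm_right_slices [OF assms(3)] by simp
qed

section \<open>Invariants of LOCC protocols\<close>

lemma locc_carrier:
  "locc p q m n D \<Longrightarrow> X \<in> carrier_mat (m * n) (m * n) \<Longrightarrow> D X \<in> carrier_mat (p * q) (p * q)"
  by (induction rule: locc.induct) (assumption, rule zero_carrier_mat, (rule mat_sum_carrier)+)

lemma mat_sum_swap:
  assumes "\<And>i l. i < k \<Longrightarrow> l < h \<Longrightarrow> Y i l \<in> carrier_mat n n"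
  shows "mat_sum n k (\<lambda>i. mat_sum n h (\<lambda>l. c l \<cdot>\<^sub>m Y i l))
       = mat_sum n h (\<lambda>l. c l \<cdot>\<^sub>m mat_sum n k (\<lambda>i. Y i l))"
proof -
  have Y: "dim_row (Y i l) = n" "dim_col (Y i l) = n" if "i < k" "l < h" for i l
    using assms [OF that] by auto
  show ?thesis
  proof (rule eq_matI)
    fix i j
    assume "i < dim_row (mat_sum n h (\<lambda>l. c l \<cdot>\<^sub>m mat_sum n k (\<lambda>i. Y i l)))"
      and "j < dim_col (mat_sum n h (\<lambda>l. c l \<cdot>\<^sub>m mat_sum n k (\<lambda>i. Y i l)))"
    then have ij: "i < n" "j < n" by auto
    have "mat_sum n k (\<lambda>i. mat_sum n h (\<lambda>l. c l \<cdot>\<^sub>m Y i l)) $$ (i, j)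
        = (\<Sum>r<k. \<Sum>l<h. c l * Y r l $$ (i, j))"
      using ij Y by simp
    also have "\<dots> = (\<Sum>l<h. \<Sum>r<k. c l * Y r l $$ (i, j))"
      by (rule sum.swap)
    finally show "mat_sum n k (\<lambda>i. mat_sum n h (\<lambda>l. c l \<cdot>\<^sub>m Y i l)) $$ (i, j)
        = mat_sum n h (\<lambda>l. c l \<cdot>\<^sub>m mat_sum n k (\<lambda>i. Y i l)) $$ (i, j)"
      using ij by (simp add: sum_distrib_left)
  qed auto
qed

lemma sandwich_carrier:
  assumes "T \<in> carrier_mat p q" "X \<in> carrier_mat q q"
  shows "T * X * mat_adjoint T \<in> carrier_mat p p"
  using assms by (intro carrier_matI) simp_all

text \<open>Conjugation by a Kraus operator leaves the weights outside
  (\<open>mult_mat_sum\<close>), and the sum over outcomes commutes with the sum over terms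
  (\<open>mat_sum_swap\<close>). Taking sums and weights together makes a single induction
  enough.\<close>

lemma locc_mat_sum:
  assumes "locc p q m n D" and "\<And>l. l < h \<Longrightarrow> X l \<in> carrier_mat (m * n) (m * n)"
  shows "D (mat_sum (m * n) h (\<lambda>l. c l \<cdot>\<^sub>m X l)) = mat_sum (p * q) h (\<lambda>l. c l \<cdot>\<^sub>m D (X l))"
  using assms
proof (induction arbitrary: X rule: locc.induct)
  case success
  show ?case by (rule refl)
next
  case (failure m n)
  show ?case by (intro eq_matI) auto
next
  case (alice k K d m n D)
  let ?T = "\<lambda>i. tensor_mat (K i) (1\<^sub>m n)"
  have T: "?T i \<in> carrier_mat (d i * n) (m * n)" if "i < k" for i
    using alice.hyps(1) [OF that] by simp
  have C: "?T i * X l * mat_adjoint (?T i) \<in> carrier_mat (d i * n) (d i * n)" if "i < k" "l < h" for i l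
    by (rule sandwich_carrier [OF T [OF that(1)] alice.prems [OF that(2)]])
  have E: "?T i * mat_sum (m * n) h (\<lambda>l. c l \<cdot>\<^sub>m X l) * mat_adjoint (?T i)
      = mat_sum (d i * n) h (\<lambda>l. c l \<cdot>\<^sub>m (?T i * X l * mat_adjoint (?T i)))" if "i < k" for i
    by (rule mult_mat_sum [OF T [OF that]]) (rule alice.prems)
  have "D i (?T i * mat_sum (m * n) h (\<lambda>l. c l \<cdot>\<^sub>m X l) * mat_adjoint (?T i))
      = mat_sum (p * q) h (\<lambda>l. c l \<cdot>\<^sub>m D i (?T i * X l * mat_adjoint (?T i)))" if "i < k" for i
    unfolding E [OF that] by (rule alice.IH [OF that]) (rule C [OF that])
  then have "mat_sum (p * q) k (\<lambda>i. D i (?T i * mat_sum (m * n) h (\<lambda>l. c l \<cdot>\<^sub>m X l) * mat_adjoint (?T i)))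
      = mat_sum (p * q) k (\<lambda>i. mat_sum (p * q) h (\<lambda>l. c l \<cdot>\<^sub>m D i (?T i * X l * mat_adjoint (?T i))))"
    by (rule mat_sum_cong)
  also have "\<dots> = mat_sum (p * q) h (\<lambda>l. c l \<cdot>\<^sub>m mat_sum (p * q) k (\<lambda>i. D i (?T i * X l * mat_adjoint (?T i))))"
    by (rule mat_sum_swap) (rule locc_carrier [OF alice.hyps(3)], assumption, rule C)
  finally show ?case .
next
  case (bob k K d n m D)
  let ?T = "\<lambda>i. tensor_mat (1\<^sub>m m) (K i)"
  have T: "?T i \<in> carrier_mat (m * d i) (m * n)" if "i < k" for i
    using bob.hyps(1) [OF that] by simp
  have C: "?T i * X l * mat_adjoint (?T i) \<in> carrier_mat (m * d i) (m * d i)" if "i < k" "l < h" for i l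
    by (rule sandwich_carrier [OF T [OF that(1)] bob.prems [OF that(2)]])
  have E: "?T i * mat_sum (m * n) h (\<lambda>l. c l \<cdot>\<^sub>m X l) * mat_adjoint (?T i)
      = mat_sum (m * d i) h (\<lambda>l. c l \<cdot>\<^sub>m (?T i * X l * mat_adjoint (?T i)))" if "i < k" for i
    by (rule mult_mat_sum [OF T [OF that]]) (rule bob.prems)
  have "D i (?T i * mat_sum (m * n) h (\<lambda>l. c l \<cdot>\<^sub>m X l) * mat_adjoint (?T i))
      = mat_sum (p * q) h (\<lambda>l. c l \<cdot>\<^sub>m D i (?T i * X l * mat_adjoint (?T i)))" if "i < k" for i
    unfolding E [OF that] by (rule bob.IH [OF that]) (rule C [OF that])
  then have "mat_sum (p * q) k (\<lambda>i. D i (?T i * mat_sum (m * n) h (\<lambda>l. c l \<cdot>\<^sub>m X l) * mat_adjoint (?T i)))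
      = mat_sum (p * q) k (\<lambda>i. mat_sum (p * q) h (\<lambda>l. c l \<cdot>\<^sub>m D i (?T i * X l * mat_adjoint (?T i))))"
    by (rule mat_sum_cong)
  also have "\<dots> = mat_sum (p * q) h (\<lambda>l. c l \<cdot>\<^sub>m mat_sum (p * q) k (\<lambda>i. D i (?T i * X l * mat_adjoint (?T i))))"
    by (rule mat_sum_swap) (rule locc_carrier [OF bob.hyps(3)], assumption, rule C)
  finally show ?case .
qed

text \<open>Up to the reordering of qubits, the indices \<open>0, 1, 4, 5\<close> run over the states
  \<open>|00\<rangle>\<close> of the kept pair, and adding \<open>10 = 8 + 2\<close> turns both kept qubits into \<open>|1\<rangle>\<close>.\<close>

definition kept_overlap :: "complex mat \<Rightarrow> complex" where
  "kept_overlap Z =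
     (\<Sum>i\<in>{0, 1, 4, 5}. Z $$ (i, i) + Z $$ (i, i + 10) + Z $$ (i + 10, i) + Z $$ (i + 10, i + 10)) / 2"

section \<open>Explicit indices of two and four qubits\<close>

lemma sum_lessThan_2: "(\<Sum>i<(2::nat). f i) = f 0 + (f 1 :: 'a::comm_monoid_add)"
  by (simp add: numeral_2_eq_2)

lemma sum_lessThan_4: "(\<Sum>i<(4::nat). f i) = f 0 + f 1 + f 2 + (f 3 :: 'a::comm_monoid_add)"
  by (simp add: eval_nat_numeral)

lemma sum_lessThan_16:
  "(\<Sum>i<(16::nat). f i) = f 0 + f 1 + f 2 + f 3 + f 4 + f 5 + f 6 + f 7
     + f 8 + f 9 + f 10 + f 11 + f 12 + f 13 + f 14 + (f 15 :: 'a::comm_monoid_add)"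
  by (simp add: eval_nat_numeral)

lemma less_16_cases:
  assumes "i < (16::nat)"
  obtains "i = 0" | "i = 1" | "i = 2" | "i = 3" | "i = 4" | "i = 5" | "i = 6" | "i = 7"
    | "i = 8" | "i = 9" | "i = 10" | "i = 11" | "i = 12" | "i = 13" | "i = 14" | "i = 15"
proof -
  have "i = 0 \<or> i = 1 \<or> i = 2 \<or> i = 3 \<or> i = 4 \<or> i = 5 \<or> i = 6 \<or> i = 7
    \<or> i = 8 \<or> i = 9 \<or> i = 10 \<or> i = 11 \<or> i = 12 \<or> i = 13 \<or> i = 14 \<or> i = 15"
    using assms by arith
  then show ?thesis
    by (elim disjE) (fact that)+
qed

lemma swap23_index_values:
  "swap23_index 0 = 0" "swap23_index 1 = 1" "swap23_index 2 = 4" "swap23_index 3 = 5"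
  "swap23_index 4 = 2" "swap23_index 5 = 3" "swap23_index 6 = 6" "swap23_index 7 = 7"
  "swap23_index 8 = 8" "swap23_index 9 = 9" "swap23_index 10 = 12" "swap23_index 11 = 13"
  "swap23_index 12 = 10" "swap23_index 13 = 11" "swap23_index 14 = 14" "swap23_index 15 = 15"
  by (simp_all add: swap23_index_def)

lemma swap23_index_less: "i < 16 \<Longrightarrow> swap23_index i < 16"
  by (erule less_16_cases) (simp_all add: swap23_index_def)

text \<open>\<open>swap23_index\<close> is the product of the transpositions (2 4), (3 5), (10 12)
  and (11 13), so it only permutes the summands.\<close>

lemma sum_swap23_index:
  "(\<Sum>i<16. f (swap23_index i)) = (\<Sum>i<16. (f i :: 'a::comm_monoid_add))"
  unfolding sum_lessThan_16 swap23_index_values by (simp only: ac_simps)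

lemma swap23_carrier [simp]: "swap23 X \<in> carrier_mat 16 16"
  by (simp add: swap23_def)

lemma mat_trace_swap23: "X \<in> carrier_mat 16 16 \<Longrightarrow> mat_trace (swap23 X) = mat_trace X"
  using sum_swap23_index [of "\<lambda>i. X $$ (i, i)"]
  by (simp add: mat_trace_def swap23_def)

lemma sqrt2_mult_sqrt2: "complex_of_real (sqrt 2) * complex_of_real (sqrt 2) = 2"
  by (simp flip: of_real_mult)

lemma Phi_plus_index:
  "dim_vec Phi_plus = 4" "Phi_plus $ 0 = complex_of_real (1 / sqrt 2)" "Phi_plus $ Suc 0 = 0"
  "Phi_plus $ 2 = 0" "Phi_plus $ 3 = complex_of_real (1 / sqrt 2)"
  by (simp_all add: Phi_plus_def ket0_def ket1_def)

text \<open>This removes the final reordering and the partial trace from all later arguments. Only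
  the entries 0 and 3 of Phi+ are nonzero, each equal to 1 / sqrt 2: hence the four corners of the
  reduced matrix and the division by 2.\<close>

lemma Phi_plus_kept_overlap:
  "(partial_trace_right 4 4 (swap23 Z) *\<^sub>v Phi_plus) \<bullet>c Phi_plus = kept_overlap Z"
proof -
  let ?P = "partial_trace_right 4 4 (swap23 Z)"
  have P: "dim_row ?P = 4" "dim_col ?P = 4"
    by (simp_all add: partial_trace_right_def)
  have "(?P *\<^sub>v Phi_plus) \<bullet>c Phi_plus
      = (?P $$ (0, 0) + ?P $$ (0, 3) + ?P $$ (3, 0) + ?P $$ (3, 3)) / 2"
    by (simp add: cscalar_prod_sum mult_mat_vec_index P Phi_plus_index sum_lessThan_4 sqrt2_mult_sqrt2 field_simps
        del: index_mult_mat_vec)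
  also have "\<dots> = kept_overlap Z"
    by (simp add: partial_trace_right_def swap23_def swap23_index_def kept_overlap_def sum_lessThan_4)
  finally show ?thesis .
qed

lemma kept_overlap_mat_sum: "kept_overlap (mat_sum 16 k M) = (\<Sum>l<k. kept_overlap (M l))"
  by (simp add: kept_overlap_def sum.distrib sum_divide_distrib add_divide_distrib)

lemma kept_overlap_smult:
  "A \<in> carrier_mat 16 16 \<Longrightarrow> kept_overlap (c \<cdot>\<^sub>m A) = c * kept_overlap A"
  by (auto simp: kept_overlap_def algebra_simps)

lemma kept_overlap_ketbra:
  assumes "v \<in> carrier_vec 16"
  shows "kept_overlap (ketbra v v)
       = complex_of_real ((\<Sum>i\<in>{0, 1, 4, 5}. (cmod (v $ i + v $ (i + 10)))\<^sup>2) / 2)"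
  unfolding of_real_divide of_real_sum complex_norm_square
  using assms by (simp add: kept_overlap_def algebra_simps carrier_vecD)

section \<open>Overlap against trace for a single output vector\<close>

lemma cmod_add_square_le: "(cmod (x + y))\<^sup>2 \<le> 2 * ((cmod x)\<^sup>2 + (cmod y)\<^sup>2)"
proof -
  have "(cmod (x + y))\<^sup>2 \<le> (cmod x + cmod y)\<^sup>2"
    by (intro power_mono norm_triangle_ineq) simp
  also have "\<dots> \<le> 2 * ((cmod x)\<^sup>2 + (cmod y)\<^sup>2)"
    using sum_squares_bound [of "cmod x" "cmod y"] by (simp add: power2_sum)
  finally show ?thesis .
qed

lemma cmod_Cauchy_Schwarz_2:
  "(cmod (x * y + z * w))\<^sup>2 \<le> ((cmod x)\<^sup>2 + (cmod z)\<^sup>2) * ((cmod y)\<^sup>2 + (cmod w)\<^sup>2)"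
proof -
  let ?a = "cmod x" and ?b = "cmod y" and ?c = "cmod z" and ?d = "cmod w"
  have "(cmod (x * y + z * w))\<^sup>2 \<le> (?a * ?b + ?c * ?d)\<^sup>2"
    using norm_triangle_ineq [of "x * y" "z * w"] by (intro power_mono) (simp_all add: norm_mult)
  also have "\<dots> \<le> (?a\<^sup>2 + ?c\<^sup>2) * (?b\<^sup>2 + ?d\<^sup>2)"
    using zero_le_power2 [of "?a * ?d - ?b * ?c"] by (simp add: algebra_simps power2_eq_square)
  finally show ?thesis .
qed

text \<open>The overlap is the expectation of a projector, Phi+ on the kept pair tensored with the
  identity. In coordinates, each pair of indices \<open>i\<close>, \<open>i + 10\<close> contributes
  at most its share of the squared norm.\<close>

lemma kept_overlap_le_trace:
  assumes "v \<in> carrier_vec 16"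
  shows "Re (kept_overlap (ketbra v v)) \<le> Re (mat_trace (ketbra v v))"
proof -
  define g where "g i = (cmod (v $ i))\<^sup>2" for i
  define h where "h i = (cmod (v $ i + v $ (i + 10)))\<^sup>2" for i
  have "h i \<le> 2 * (g i + g (i + 10))" for i
    unfolding h_def g_def by (rule cmod_add_square_le)
  from this [of 0] this [of 1] this [of 4] this [of 5]
  have h: "h 0 + h 1 + h 4 + h 5 \<le> 2 * (g 0 + g 10 + g 1 + g 11 + g 4 + g 14 + g 5 + g 15)"
    by simp
  have g: "g i \<ge> 0" for i
    by (simp add: g_def)
  have "2 * Re (kept_overlap (ketbra v v)) = h 0 + h 1 + h 4 + h 5"
    unfolding kept_overlap_ketbra [OF assms] h_def by simp
  moreover have "Re (mat_trace (ketbra v v)) = (\<Sum>i<16. g i)"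
    unfolding mat_trace_ketbra cscalar_prod_self carrier_vecD [OF assms] g_def by simp
  \<comment> \<open>These are the eight indices at which the two kept qubits differ; they count for
    the trace but not for the overlap.\<close>
  moreover have "0 \<le> g 2 + g 3 + g 6 + g 7 + g 8 + g 9 + g 12 + g 13"
    by (intro add_nonneg_nonneg g)
  ultimately show ?thesis
    using h unfolding sum_lessThan_16 by argo
qed

text \<open>For fixed values of the discarded qubits the amplitude pairs two entries of
  \<open>u\<close> with two entries of \<open>w\<close>, and Cauchy-Schwarz bounds it. The four
  bounds add up to the product of the squared norms of \<open>u\<close> and \<open>w\<close>, which
  is the trace.\<close>

lemma kept_overlap_product:
  assumes u: "u \<in> carrier_vec 4" and w: "w \<in> carrier_vec 4"
  defines "v \<equiv> tensor_vec u w"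
  shows "2 * Re (kept_overlap (ketbra v v)) \<le> Re (mat_trace (ketbra v v))"
proof -
  have v: "v \<in> carrier_vec 16"
    using tensor_vec_carrier [OF u w] by (simp add: v_def)
  define U where "U i = (cmod (u $ i))\<^sup>2" for i
  define W where "W i = (cmod (w $ i))\<^sup>2" for i
  define h where "h i = (cmod (v $ i + v $ (i + 10)))\<^sup>2" for i
  \<comment> \<open>In \<open>u\<close> and in \<open>w\<close> the discarded qubit is 0 at entries
    0 and 2, and 1 at entries 1 and 3.\<close>
  have "v $ 0 + v $ (0 + 10) = u $ 0 * w $ 0 + u $ 2 * w $ 2"
    "v $ 1 + v $ (1 + 10) = u $ 0 * w $ 1 + u $ 2 * w $ 3"
    "v $ 4 + v $ (4 + 10) = u $ 1 * w $ 0 + u $ 3 * w $ 2"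
    "v $ 5 + v $ (5 + 10) = u $ 1 * w $ 1 + u $ 3 * w $ 3"
    using u w by (simp_all add: v_def carrier_vecD)
  then have h: "h 0 \<le> (U 0 + U 2) * (W 0 + W 2)" "h 1 \<le> (U 0 + U 2) * (W 1 + W 3)"
    "h 4 \<le> (U 1 + U 3) * (W 0 + W 2)" "h 5 \<le> (U 1 + U 3) * (W 1 + W 3)"
    unfolding h_def U_def W_def by (simp_all only: cmod_Cauchy_Schwarz_2)
  have "2 * Re (kept_overlap (ketbra v v)) = h 0 + h 1 + h 4 + h 5"
    unfolding kept_overlap_ketbra [OF v] h_def by simp
  also have "\<dots> \<le> (\<Sum>i<4. U i) * (\<Sum>i<4. W i)"
    using h unfolding sum_lessThan_4 by (simp add: algebra_simps)
  also have "\<dots> = Re (mat_trace (ketbra v v))"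
    unfolding v_def mat_trace_ketbra cscalar_prod_tensor [OF refl refl]
    using u w by (simp add: cscalar_prod_self carrier_vecD U_def W_def)
  finally show ?thesis .
qed

text \<open>Every branch carries a rank-one operator until it ends in success or failure, and all
  claims survive summation over outcomes. The last bound is conservation of norm under a complete
  measurement. Reality is recorded because \<open>locc_joint_state\<close> rebuilds the complex
  trace and overlap from their real parts.\<close>

lemma locc_ketbra_bounds:
  assumes "locc 4 4 m n D" "v \<in> carrier_vec (m * n)"
  shows "mat_trace (D (ketbra v v)) \<in> \<real> \<and> kept_overlap (D (ketbra v v)) \<in> \<real>
    \<and> 0 \<le> Re (kept_overlap (D (ketbra v v)))
    \<and> Re (kept_overlap (D (ketbra v v))) \<le> Re (mat_trace (D (ketbra v v)))
    \<and> Re (mat_trace (D (ketbra v v))) \<le> Re (v \<bullet>c v)"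
  using assms
proof (induction arbitrary: v rule: locc.induct)
  case success
  then have v: "v \<in> carrier_vec 16" by simp
  show ?case
    using kept_overlap_le_trace [OF v]
    by (simp add: kept_overlap_ketbra [OF v] mat_trace_ketbra cscalar_prod_self sum_nonneg)
next
  case (failure m n)
  show ?case
    by (simp add: kept_overlap_def mat_trace_def cscalar_prod_self sum_nonneg)
next
  case (alice k K d m n D)
  let ?T = "\<lambda>i. tensor_mat (K i) (1\<^sub>m n)"
  let ?w = "\<lambda>i. ?T i *\<^sub>v v"
  have T: "?T i \<in> carrier_mat (d i * n) (m * n)" if "i < k" for i
    using alice.hyps(1) [OF that] by simp
  have w: "?w i \<in> carrier_vec (d i * n)" if "i < k" for i
    by (rule mult_mat_vec_carrier [OF T [OF that] alice.prems])
  have X: "mat_sum (4 * 4) k (\<lambda>i. D i (?T i * ketbra v v * mat_adjoint (?T i)))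
      = mat_sum 16 k (\<lambda>i. D i (ketbra (?w i) (?w i)))"
    by (simp add: mat_sum_def mult_ketbra [OF T alice.prems])
  have C: "D i (ketbra (?w i) (?w i)) \<in> carrier_mat 16 16" if "i < k" for i
    using locc_carrier [OF alice.hyps(3) [OF that] ketbra_carrier [OF w [OF that] w [OF that]]] by simp
  have tr: "mat_trace (mat_sum 16 k (\<lambda>i. D i (ketbra (?w i) (?w i))))
      = (\<Sum>i<k. mat_trace (D i (ketbra (?w i) (?w i))))"
    by (rule mat_trace_mat_sum) (rule C)
  have IH: "mat_trace (D i (ketbra (?w i) (?w i))) \<in> \<real> \<and> kept_overlap (D i (ketbra (?w i) (?w i))) \<in> \<real>
    \<and> 0 \<le> Re (kept_overlap (D i (ketbra (?w i) (?w i))))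
    \<and> Re (kept_overlap (D i (ketbra (?w i) (?w i)))) \<le> Re (mat_trace (D i (ketbra (?w i) (?w i))))
    \<and> Re (mat_trace (D i (ketbra (?w i) (?w i)))) \<le> Re (?w i \<bullet>c ?w i)" if "i \<in> {..<k}" for i
    using that by (intro alice.IH w) auto
  have "(\<Sum>i<k. Re (mat_trace (D i (ketbra (?w i) (?w i))))) \<le> (\<Sum>i<k. Re (?w i \<bullet>c ?w i))"
    using IH by (intro sum_mono) blast
  also have "\<dots> = Re (v \<bullet>c v)"
    using kraus_norm_tensor_right [OF alice.hyps(1,2) alice.prems] by (simp flip: Re_sum)
  finally have le: "(\<Sum>i<k. Re (mat_trace (D i (ketbra (?w i) (?w i))))) \<le> Re (v \<bullet>c v)" .
  show ?case
    unfolding X tr kept_overlap_mat_sum Re_sum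
  proof (intro conjI)
    show "(\<Sum>i<k. mat_trace (D i (ketbra (?w i) (?w i)))) \<in> \<real>"
      by (rule sum_in_Reals) (use IH in blast)
    show "(\<Sum>i<k. kept_overlap (D i (ketbra (?w i) (?w i)))) \<in> \<real>"
      by (rule sum_in_Reals) (use IH in blast)
    show "0 \<le> (\<Sum>i<k. Re (kept_overlap (D i (ketbra (?w i) (?w i)))))"
      by (rule sum_nonneg) (use IH in blast)
    show "(\<Sum>i<k. Re (kept_overlap (D i (ketbra (?w i) (?w i)))))
        \<le> (\<Sum>i<k. Re (mat_trace (D i (ketbra (?w i) (?w i)))))"
      by (rule sum_mono) (use IH in blast)
    show "(\<Sum>i<k. Re (mat_trace (D i (ketbra (?w i) (?w i))))) \<le> Re (v \<bullet>c v)"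
      by (rule le)
  qed
next
  case (bob k K d n m D)
  let ?T = "\<lambda>i. tensor_mat (1\<^sub>m m) (K i)"
  let ?w = "\<lambda>i. ?T i *\<^sub>v v"
  have T: "?T i \<in> carrier_mat (m * d i) (m * n)" if "i < k" for i
    using bob.hyps(1) [OF that] by simp
  have w: "?w i \<in> carrier_vec (m * d i)" if "i < k" for i
    by (rule mult_mat_vec_carrier [OF T [OF that] bob.prems])
  have X: "mat_sum (4 * 4) k (\<lambda>i. D i (?T i * ketbra v v * mat_adjoint (?T i)))
      = mat_sum 16 k (\<lambda>i. D i (ketbra (?w i) (?w i)))"
    by (simp add: mat_sum_def mult_ketbra [OF T bob.prems])
  have C: "D i (ketbra (?w i) (?w i)) \<in> carrier_mat 16 16" if "i < k" for i
    using locc_carrier [OF bob.hyps(3) [OF that] ketbra_carrier [OF w [OF that] w [OF that]]] by simp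
  have tr: "mat_trace (mat_sum 16 k (\<lambda>i. D i (ketbra (?w i) (?w i))))
      = (\<Sum>i<k. mat_trace (D i (ketbra (?w i) (?w i))))"
    by (rule mat_trace_mat_sum) (rule C)
  have IH: "mat_trace (D i (ketbra (?w i) (?w i))) \<in> \<real> \<and> kept_overlap (D i (ketbra (?w i) (?w i))) \<in> \<real>
    \<and> 0 \<le> Re (kept_overlap (D i (ketbra (?w i) (?w i))))
    \<and> Re (kept_overlap (D i (ketbra (?w i) (?w i)))) \<le> Re (mat_trace (D i (ketbra (?w i) (?w i))))
    \<and> Re (mat_trace (D i (ketbra (?w i) (?w i)))) \<le> Re (?w i \<bullet>c ?w i)" if "i \<in> {..<k}" for i
    using that by (intro bob.IH w) auto
  have "(\<Sum>i<k. Re (mat_trace (D i (ketbra (?w i) (?w i))))) \<le> (\<Sum>i<k. Re (?w i \<bullet>c ?w i))"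
    using IH by (intro sum_mono) blast
  also have "\<dots> = Re (v \<bullet>c v)"
    using kraus_norm_tensor_left [OF bob.hyps(1,2) bob.prems] by (simp flip: Re_sum)
  finally have le: "(\<Sum>i<k. Re (mat_trace (D i (ketbra (?w i) (?w i))))) \<le> Re (v \<bullet>c v)" .
  show ?case
    unfolding X tr kept_overlap_mat_sum Re_sum
  proof (intro conjI)
    show "(\<Sum>i<k. mat_trace (D i (ketbra (?w i) (?w i)))) \<in> \<real>"
      by (rule sum_in_Reals) (use IH in blast)
    show "(\<Sum>i<k. kept_overlap (D i (ketbra (?w i) (?w i)))) \<in> \<real>"
      by (rule sum_in_Reals) (use IH in blast)
    show "0 \<le> (\<Sum>i<k. Re (kept_overlap (D i (ketbra (?w i) (?w i)))))"
      by (rule sum_nonneg) (use IH in blast)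
    show "(\<Sum>i<k. Re (kept_overlap (D i (ketbra (?w i) (?w i)))))
        \<le> (\<Sum>i<k. Re (mat_trace (D i (ketbra (?w i) (?w i)))))"
      by (rule sum_mono) (use IH in blast)
    show "(\<Sum>i<k. Re (mat_trace (D i (ketbra (?w i) (?w i))))) \<le> Re (v \<bullet>c v)"
      by (rule le)
  qed
qed

text \<open>A local operator maps a product vector to a product vector, so no branch creates
  entanglement and \<open>kept_overlap_product\<close> applies at its end.\<close>

lemma locc_product_bound:
  assumes "locc 4 4 m n D" "u \<in> carrier_vec m" "w \<in> carrier_vec n"
  shows "2 * Re (kept_overlap (D (ketbra (tensor_vec u w) (tensor_vec u w))))
       \<le> Re (mat_trace (D (ketbra (tensor_vec u w) (tensor_vec u w))))"
  using assms
proof (induction arbitrary: u w rule: locc.induct)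
  case success
  then show ?case by (rule kept_overlap_product)
next
  case (failure m n)
  show ?case by (simp add: kept_overlap_def mat_trace_def)
next
  case (alice k K d m n D)
  let ?v = "tensor_vec u w" and ?T = "\<lambda>i. tensor_mat (K i) (1\<^sub>m n)"
  let ?v' = "\<lambda>i. tensor_vec (K i *\<^sub>v u) w"
  have u': "K i *\<^sub>v u \<in> carrier_vec (d i)" if "i < k" for i
    by (rule mult_mat_vec_carrier [OF alice.hyps(1) [OF that] alice.prems(1)])
  have "?T i * ketbra ?v ?v * mat_adjoint (?T i) = ketbra (?v' i) (?v' i)" if "i < k" for i
    unfolding mult_ketbra [OF tensor_mat_carrier [OF alice.hyps(1) [OF that] one_carrier_mat] tensor_vec_carrier [OF alice.prems]]
      tensor_mat_mult_vec [OF alice.hyps(1) [OF that] one_carrier_mat alice.prems]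
    using alice.prems(2) by simp
  then have X: "mat_sum (4 * 4) k (\<lambda>i. D i (?T i * ketbra ?v ?v * mat_adjoint (?T i)))
      = mat_sum 16 k (\<lambda>i. D i (ketbra (?v' i) (?v' i)))"
    by (simp add: mat_sum_def)
  have C: "D i (ketbra (?v' i) (?v' i)) \<in> carrier_mat 16 16" if "i < k" for i
    using locc_carrier [OF alice.hyps(3) [OF that]] u' [OF that] alice.prems(2) by simp
  have tr: "mat_trace (mat_sum 16 k (\<lambda>i. D i (ketbra (?v' i) (?v' i))))
      = (\<Sum>i<k. mat_trace (D i (ketbra (?v' i) (?v' i))))"
    by (rule mat_trace_mat_sum) (rule C)
  show ?case
    unfolding X tr kept_overlap_mat_sum Re_sum sum_distrib_left
    by (rule sum_mono) (rule alice.IH, simp, rule u', simp, rule alice.prems(2))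
next
  case (bob k K d n m D)
  let ?v = "tensor_vec u w" and ?T = "\<lambda>i. tensor_mat (1\<^sub>m m) (K i)"
  let ?v' = "\<lambda>i. tensor_vec u (K i *\<^sub>v w)"
  have w': "K i *\<^sub>v w \<in> carrier_vec (d i)" if "i < k" for i
    by (rule mult_mat_vec_carrier [OF bob.hyps(1) [OF that] bob.prems(2)])
  have "?T i * ketbra ?v ?v * mat_adjoint (?T i) = ketbra (?v' i) (?v' i)" if "i < k" for i
    unfolding mult_ketbra [OF tensor_mat_carrier [OF one_carrier_mat bob.hyps(1) [OF that]] tensor_vec_carrier [OF bob.prems]]
      tensor_mat_mult_vec [OF one_carrier_mat bob.hyps(1) [OF that] bob.prems]
    using bob.prems(1) by simp
  then have X: "mat_sum (4 * 4) k (\<lambda>i. D i (?T i * ketbra ?v ?v * mat_adjoint (?T i)))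
      = mat_sum 16 k (\<lambda>i. D i (ketbra (?v' i) (?v' i)))"
    by (simp add: mat_sum_def)
  have C: "D i (ketbra (?v' i) (?v' i)) \<in> carrier_mat 16 16" if "i < k" for i
    using locc_carrier [OF bob.hyps(3) [OF that]] w' [OF that] bob.prems(1) by simp
  have tr: "mat_trace (mat_sum 16 k (\<lambda>i. D i (ketbra (?v' i) (?v' i))))
      = (\<Sum>i<k. mat_trace (D i (ketbra (?v' i) (?v' i))))"
    by (rule mat_trace_mat_sum) (rule C)
  show ?case
    unfolding X tr kept_overlap_mat_sum Re_sum sum_distrib_left
    by (rule sum_mono) (rule bob.IH, simp, rule bob.prems(1), rule w', simp)
qed

section \<open>Two copies of a mixture\<close>

definition swap_vec :: "complex vec \<Rightarrow> complex vec" where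
  "swap_vec v = vec 16 (\<lambda>i. v $ swap23_index i)"

lemma swap_vec_carrier [simp]: "swap_vec v \<in> carrier_vec 16"
  by (simp add: swap_vec_def)

lemma swap_vec_dim [simp]: "dim_vec (swap_vec v) = 16"
  by (simp add: swap_vec_def)

lemma swap_vec_index [simp]: "i < 16 \<Longrightarrow> swap_vec v $ i = v $ swap23_index i"
  by (simp add: swap_vec_def)

lemma swap23_ketbra: "v \<in> carrier_vec 16 \<Longrightarrow> swap23 (ketbra v v) = ketbra (swap_vec v) (swap_vec v)"
  by (rule eq_matI) (auto simp: swap23_def swap23_index_less)

lemma swap23_mat_sum:
  assumes "\<And>l. l < k \<Longrightarrow> X l \<in> carrier_mat 16 16"
  shows "swap23 (mat_sum 16 k (\<lambda>l. c l \<cdot>\<^sub>m X l)) = mat_sum 16 k (\<lambda>l. c l \<cdot>\<^sub>m swap23 (X l))"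
proof -
  have "dim_row (X l) = 16" "dim_col (X l) = 16" if "l < k" for l
    using assms [OF that] by auto
  then show ?thesis
    by (intro eq_matI) (auto simp: swap23_def swap23_index_less)
qed

lemma swap_vec_tensor:
  assumes "a \<in> carrier_vec 2" "b \<in> carrier_vec 2" "c \<in> carrier_vec 2" "d \<in> carrier_vec 2"
  shows "swap_vec (tensor_vec (tensor_vec a b) (tensor_vec c d))
       = tensor_vec (tensor_vec a c) (tensor_vec b d)"
proof (rule eq_vecI)
  fix i
  assume "i < dim_vec (tensor_vec (tensor_vec a c) (tensor_vec b d))"
  then have "i < 16"
    using assms by (simp add: carrier_vecD)
  then show "swap_vec (tensor_vec (tensor_vec a b) (tensor_vec c d)) $ i
      = tensor_vec (tensor_vec a c) (tensor_vec b d) $ i"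
    by (rule less_16_cases) (simp_all add: swap23_index_def carrier_vecD [OF assms(1)]
        carrier_vecD [OF assms(2)] carrier_vecD [OF assms(3)] carrier_vecD [OF assms(4)])
qed (use assms in \<open>simp add: carrier_vecD\<close>)

lemma norm_swap_vec: "v \<in> carrier_vec 16 \<Longrightarrow> swap_vec v \<bullet>c swap_vec v = v \<bullet>c v"
  using sum_swap23_index [of "\<lambda>i. v $ i * cnj (v $ i)"]
  by (simp add: cscalar_prod_sum carrier_vecD)

text \<open>The weights need not add up to 1: they are probabilities for the given state, and
  constantly 1 for the projector to which the separability bound is applied.\<close>

definition mixture :: "(nat \<Rightarrow> complex) \<Rightarrow> (nat \<Rightarrow> complex vec) \<Rightarrow> complex mat" where
  "mixture c f = mat_sum 4 2 (\<lambda>i. c i \<cdot>\<^sub>m ketbra (f i) (f i))"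

text \<open>For \<open>s < 4\<close> the binary digits of \<open>s\<close> select the vectors of the
  first and of the second pair. The result is already in Alice-Bob order.\<close>

definition joint_vec :: "(nat \<Rightarrow> complex vec) \<Rightarrow> nat \<Rightarrow> complex vec" where
  "joint_vec f s = swap_vec (tensor_vec (f (s div 2)) (f (s mod 2)))"

lemma joint_vec_carrier [simp]: "joint_vec f s \<in> carrier_vec 16"
  by (simp add: joint_vec_def)

lemma joint_vec_dim [simp]: "dim_vec (joint_vec f s) = 16"
  by (simp add: joint_vec_def)

lemma mixture_index:
  assumes "\<And>i. f i \<in> carrier_vec 4" "x < 4" "y < 4"
  shows "mixture c f $$ (x, y) = (\<Sum>i<2. c i * (f i $ x * cnj (f i $ y)))"
proof -
  have "dim_vec (f i) = 4" for i
    using assms(1) [of i] by simp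
  then show ?thesis
    using assms(2,3) by (simp add: mixture_def)
qed

lemma swap23_joint_state:
  assumes f: "\<And>i. f i \<in> carrier_vec 4"
  shows "swap23 (joint_state (mixture c f))
    = mat_sum 16 4 (\<lambda>s. (c (s div 2) * c (s mod 2)) \<cdot>\<^sub>m ketbra (joint_vec f s) (joint_vec f s))"
proof -
  let ?t = "\<lambda>s. tensor_vec (f (s div 2)) (f (s mod 2))"
  have d: "dim_vec (f i) = 4" for i
    using f [of i] by simp
  have t: "?t s \<in> carrier_vec 16" for s
    using tensor_vec_carrier [OF f f] by simp
  have m: "dim_row (mixture c f) = 4" "dim_col (mixture c f) = 4"
    by (simp_all add: mixture_def)
  have "joint_state (mixture c f)
      = mat_sum 16 4 (\<lambda>s. (c (s div 2) * c (s mod 2)) \<cdot>\<^sub>m ketbra (?t s) (?t s))" (is "?l = ?r")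
  proof (rule eq_matI)
    fix i j
    assume "i < dim_row ?r" "j < dim_col ?r"
    then have ij: "i < 16" "j < 16" by auto
    then have ij4: "i div 4 < 4" "j div 4 < 4" by auto
    let ?g = "\<lambda>p q. c p * (f p $ (i div 4) * cnj (f p $ (j div 4))) * (c q * (f q $ (i mod 4) * cnj (f q $ (j mod 4))))"
    have "?l $$ (i, j) = mixture c f $$ (i div 4, j div 4) * mixture c f $$ (i mod 4, j mod 4)"
      using ij by (simp add: joint_state_def m)
    also have "\<dots> = (\<Sum>p<2. \<Sum>q<2. ?g p q)"
      using ij4 by (simp add: mixture_index [OF f] sum_product)
    \<comment> \<open>The choices \<open>p\<close> and \<open>q\<close> for the two copies become
      the single index \<open>s = 2 * p + q\<close>.\<close>
    also have "\<dots> = (\<Sum>s<2 * 2. ?g (s div 2) (s mod 2))"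
      by (rule sum_lessThan_mult [symmetric])
    also have "\<dots> = ?r $$ (i, j)"
      using ij by (simp add: d mult_ac)
    finally show "?l $$ (i, j) = ?r $$ (i, j)" .
  qed (simp_all add: joint_state_def m)
  then have "swap23 (joint_state (mixture c f))
      = mat_sum 16 4 (\<lambda>s. (c (s div 2) * c (s mod 2)) \<cdot>\<^sub>m swap23 (ketbra (?t s) (?t s)))"
    using t by (simp only: swap23_mat_sum [OF ketbra_carrier [OF t t]])
  then show ?thesis
    by (simp only: swap23_ketbra [OF t] joint_vec_def)
qed

text \<open>By linearity a protocol enters the problem only through eight real numbers, its trace
  and overlap on each of the four pure joint states. At success probability zero the second equation
  reads 0 = 0, by the convention for division.\<close>

lemma locc_joint_state:
  fixes w :: "nat \<Rightarrow> real"
  assumes L: "locc 4 4 4 4 L" and f: "\<And>i. f i \<in> carrier_vec 4"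
  defines "D \<equiv> \<lambda>X. swap23 (L (swap23 X))"
    and "\<rho> \<equiv> mixture (\<lambda>i. complex_of_real (w i)) f"
    and "\<tau> \<equiv> \<lambda>s. Re (mat_trace (L (ketbra (joint_vec f s) (joint_vec f s))))"
    and "\<phi> \<equiv> \<lambda>s. Re (kept_overlap (L (ketbra (joint_vec f s) (joint_vec f s))))"
  shows "success_prob D \<rho> = (\<Sum>s<4. w (s div 2) * w (s mod 2) * \<tau> s)"
    and "fidelity D \<rho> = (\<Sum>s<4. w (s div 2) * w (s mod 2) * \<phi> s) / success_prob D \<rho>"
proof -
  let ?X = "\<lambda>s. ketbra (joint_vec f s) (joint_vec f s)"
  have X: "?X s \<in> carrier_mat (4 * 4) (4 * 4)" for s by simp
  have LX: "L (?X s) \<in> carrier_mat 16 16" for s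
    using locc_carrier [OF L X] by simp
  have S: "L (swap23 (joint_state \<rho>))
      = mat_sum 16 4 (\<lambda>s. complex_of_real (w (s div 2) * w (s mod 2)) \<cdot>\<^sub>m L (?X s))"
    using locc_mat_sum [OF L X, where h = 4 and c = "\<lambda>s. complex_of_real (w (s div 2) * w (s mod 2))"]
    unfolding \<rho>_def swap23_joint_state [OF f] by simp
  have t: "mat_trace (L (?X s)) = complex_of_real (\<tau> s)"
    and o: "kept_overlap (L (?X s)) = complex_of_real (\<phi> s)" for s
    using locc_ketbra_bounds [OF L, of "joint_vec f s"] by (simp_all add: \<tau>_def \<phi>_def)
  have "mat_trace (D (joint_state \<rho>)) = mat_trace (L (swap23 (joint_state \<rho>)))"
    unfolding D_def S by (rule mat_trace_swap23) simp
  also have "\<dots> = (\<Sum>s<4. mat_trace (complex_of_real (w (s div 2) * w (s mod 2)) \<cdot>\<^sub>m L (?X s)))"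
    unfolding S by (rule mat_trace_mat_sum) (use LX in simp)
  finally have tr: "mat_trace (D (joint_state \<rho>))
      = complex_of_real (\<Sum>s<4. w (s div 2) * w (s mod 2) * \<tau> s)"
    by (simp add: mat_trace_smult [OF LX] t)
  then show p: "success_prob D \<rho> = (\<Sum>s<4. w (s div 2) * w (s mod 2) * \<tau> s)"
    by (simp add: success_prob_def)
  have ov: "kept_overlap (L (swap23 (joint_state \<rho>)))
      = complex_of_real (\<Sum>s<4. w (s div 2) * w (s mod 2) * \<phi> s)"
    unfolding S by (simp add: kept_overlap_mat_sum kept_overlap_smult [OF LX] o)
  let ?P = "partial_trace_right 4 4 (D (joint_state \<rho>))"
  have "(1 / mat_trace (D (joint_state \<rho>)) \<cdot>\<^sub>m ?P *\<^sub>v Phi_plus) \<bullet>c Phi_plus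
      = 1 / mat_trace (D (joint_state \<rho>)) * ((?P *\<^sub>v Phi_plus) \<bullet>c Phi_plus)"
    by (simp add: cscalar_prod_sum mult_mat_vec_index Phi_plus_index(1) partial_trace_right_def
        sum_distrib_left sum_divide_distrib sum_distrib_right del: index_mult_mat_vec)
  also have "\<dots> = complex_of_real ((\<Sum>s<4. w (s div 2) * w (s mod 2) * \<phi> s) / success_prob D \<rho>)"
    unfolding tr p [symmetric] by (simp add: D_def Phi_plus_kept_overlap ov)
  finally show "fidelity D \<rho> = (\<Sum>s<4. w (s div 2) * w (s mod 2) * \<phi> s) / success_prob D \<rho>"
    by (simp add: fidelity_def output_state_def)
qed

text \<open>A linear optimisation over these eight numbers. The fidelity bound is stated with
  denominators cleared, so that equality can be exploited without dividing.\<close>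

lemma optimal_tradeoff:
  fixes F p f :: real and \<tau> \<phi> :: "nat \<Rightarrow> real"
  assumes F: "1 / 2 < F" "F \<le> 1"
    and bounds: "\<And>s. 0 \<le> \<phi> s" "\<And>s. \<phi> s \<le> \<tau> s" "\<tau> 0 \<le> 1"
    and half: "2 * (\<phi> 0 + \<phi> 1 + \<phi> 2 + \<phi> 3) \<le> \<tau> 0 + \<tau> 1 + \<tau> 2 + \<tau> 3"
    and p: "p = F\<^sup>2 * \<tau> 0 + F * (1 - F) * (\<tau> 1 + \<tau> 2) + (1 - F)\<^sup>2 * \<tau> 3"
    and f: "f = F\<^sup>2 * \<phi> 0 + F * (1 - F) * (\<phi> 1 + \<phi> 2) + (1 - F)\<^sup>2 * \<phi> 3"
  shows "f * (F\<^sup>2 + (1 - F)\<^sup>2) \<le> F\<^sup>2 * p"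
    and "f * (F\<^sup>2 + (1 - F)\<^sup>2) = F\<^sup>2 * p \<Longrightarrow> p \<le> F\<^sup>2 + (1 - F)\<^sup>2"
proof -
  let ?e = "1 - F"
  have e: "0 \<le> ?e" "?e < F" using F by auto
  have e1: "?e\<^sup>2 \<le> F\<^sup>2" "?e\<^sup>2 \<le> F * ?e" "F * ?e \<le> F\<^sup>2"
    using e by (auto simp: power2_eq_square intro: mult_mono)
  let ?S = "\<phi> 0 + \<phi> 1 + \<phi> 2 + \<phi> 3"
  have "?e\<^sup>2 * ?S \<le> ?e\<^sup>2 * ((\<tau> 0 - \<phi> 0) + (\<tau> 1 - \<phi> 1) + (\<tau> 2 - \<phi> 2) + (\<tau> 3 - \<phi> 3))"
    using half by (intro mult_left_mono) auto
  \<comment> \<open>All differences are nonnegative and (1 - F)^2 is the least weight, so restoring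
    the true weights can only increase the sum.\<close>
  also have "\<dots> \<le> F\<^sup>2 * (\<tau> 0 - \<phi> 0) + F * ?e * (\<tau> 1 - \<phi> 1) + F * ?e * (\<tau> 2 - \<phi> 2) + ?e\<^sup>2 * (\<tau> 3 - \<phi> 3)"
    unfolding distrib_left using bounds(2) e1 by (intro add_mono mult_right_mono) auto
  also have "\<dots> = p - f"
    unfolding p f by (simp add: algebra_simps)
  finally have low: "?e\<^sup>2 * ?S \<le> p - f" .
  \<comment> \<open>\<open>r\<close> is what \<open>f\<close> loses against giving every overlap the
    largest weight. Keeping it in \<open>key\<close> is what makes the case of equality
    informative.\<close>
  define r where "r = (F\<^sup>2 - F * ?e) * (\<phi> 1 + \<phi> 2) + (F\<^sup>2 - ?e\<^sup>2) * \<phi> 3"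
  have fr: "f = F\<^sup>2 * ?S - r"
    unfolding f r_def by (simp add: algebra_simps)
  have r: "0 \<le> r"
    unfolding r_def using e1 bounds(1) by (intro add_nonneg_nonneg mult_nonneg_nonneg) auto
  have key: "f * (F\<^sup>2 + ?e\<^sup>2) \<le> F\<^sup>2 * p - ?e\<^sup>2 * r"
  proof -
    have "?e\<^sup>2 * f = F\<^sup>2 * (?e\<^sup>2 * ?S) - ?e\<^sup>2 * r"
      unfolding fr by (simp add: algebra_simps)
    also have "\<dots> \<le> F\<^sup>2 * (p - f) - ?e\<^sup>2 * r"
      using low by (intro diff_right_mono mult_left_mono) auto
    finally show ?thesis by (simp add: algebra_simps)
  qed
  moreover have "0 \<le> ?e\<^sup>2 * r" using r by simp
  ultimately show "f * (F\<^sup>2 + ?e\<^sup>2) \<le> F\<^sup>2 * p" by linarith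
  assume eq: "f * (F\<^sup>2 + ?e\<^sup>2) = F\<^sup>2 * p"
  have "f \<le> F\<^sup>2"
  proof -
    have "f = F\<^sup>2 * \<phi> 0"
    \<comment> \<open>For \<open>?e = 0\<close> the estimate \<open>key\<close> says nothing about
      \<open>r\<close>, but then the error states have weight zero in \<open>f\<close>.\<close>
    proof (cases "?e = 0")
      case True
      then show ?thesis unfolding f by simp
    next
      case False
      with key eq have "r \<le> 0"
        by (smt (verit) mult_pos_pos zero_less_power2)
      with r have "r = 0" by simp
      moreover have "0 \<le> (F\<^sup>2 - F * ?e) * (\<phi> 1 + \<phi> 2)" "0 \<le> (F\<^sup>2 - ?e\<^sup>2) * \<phi> 3"
        using e1 bounds(1) by (auto intro!: mult_nonneg_nonneg add_nonneg_nonneg)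
      ultimately have "(F\<^sup>2 - F * ?e) * (\<phi> 1 + \<phi> 2) = 0" "(F\<^sup>2 - ?e\<^sup>2) * \<phi> 3 = 0"
        unfolding r_def by linarith+
      \<comment> \<open>Here F > 1/2 is used strictly: no error state has the largest
        weight.\<close>
      moreover have "F\<^sup>2 - F * ?e \<noteq> 0" "F\<^sup>2 - ?e\<^sup>2 \<noteq> 0"
        using e F by (auto simp: power2_eq_square algebra_simps)
      ultimately have "\<phi> 1 + \<phi> 2 = 0" "\<phi> 3 = 0" by auto
      then show ?thesis unfolding f by simp
    qed
    also have "\<dots> \<le> F\<^sup>2 * 1"
      using bounds(2) [of 0] bounds(3) by (intro mult_left_mono) auto
    finally show ?thesis by simp
  qed
  then have "F\<^sup>2 * p \<le> F\<^sup>2 * (F\<^sup>2 + ?e\<^sup>2)"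
    unfolding eq [symmetric] by (intro mult_right_mono) auto
  then show "p \<le> F\<^sup>2 + ?e\<^sup>2"
    using F by simp
qed

section \<open>The parity protocol\<close>

text \<open>The family is indexed by all natural numbers. Requiring the dimension at every index
  keeps carrier facts free of range conditions; orthogonality concerns only the first
  \<open>n\<close> vectors.\<close>

definition orthonormal :: "nat \<Rightarrow> (nat \<Rightarrow> complex vec) \<Rightarrow> bool" where
  "orthonormal n e \<longleftrightarrow> (\<forall>i. e i \<in> carrier_vec n) \<and> (\<forall>i<n. \<forall>j<n. e i \<bullet>c e j = (if i = j then 1 else 0))"

text \<open>The rows of \<open>W\<close> are the conjugated vectors, so orthonormality says that
  \<open>W\<close> times its adjoint is 1. For square matrices the reverse product is then 1 too,
  and that is the completeness relation.\<close>

lemma orthonormal_complete: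
  assumes e: "orthonormal n e" and xy: "x < n" "y < n"
  shows "(\<Sum>k<n. e k $ x * cnj (e k $ y)) = (if x = y then 1 else 0)"
proof -
  define W where "W = mat n n (\<lambda>(k, x). cnj (e k $ x))"
  have d: "dim_vec (e k) = n" for k
    using e by (auto simp: orthonormal_def)
  have W: "W \<in> carrier_mat n n" "mat_adjoint W \<in> carrier_mat n n"
    by (auto simp: W_def intro!: carrier_matI)
  have "W * mat_adjoint W = 1\<^sub>m n"
  proof (rule eq_matI)
    fix k l
    assume "k < dim_row (1\<^sub>m n :: complex mat)" "l < dim_col (1\<^sub>m n :: complex mat)"
    then have kl: "k < n" "l < n" by auto
    then have "(W * mat_adjoint W) $$ (k, l) = e l \<bullet>c e k"
      using W by (simp add: mult_mat_index cscalar_prod_sum d W_def mult.commute del: index_mult_mat(1))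
    then show "(W * mat_adjoint W) $$ (k, l) = 1\<^sub>m n $$ (k, l)"
      using e kl by (auto simp: orthonormal_def)
  qed (use W in auto)
  then have "mat_adjoint W * W = 1\<^sub>m n"
    by (rule mat_mult_left_right_inverse [OF W])
  then have "(mat_adjoint W * W) $$ (x, y) = 1\<^sub>m n $$ (x, y)"
    by simp
  then show ?thesis
    using xy W by (simp add: mult_mat_index W_def del: index_mult_mat(1))
qed

lemma orthonormal_tensor:
  assumes "orthonormal 2 e"
  shows "orthonormal 4 (\<lambda>k. tensor_vec (e (k div 2)) (e (k mod 2)))"
proof -
  have e: "e i \<in> carrier_vec 2" for i
    using assms by (simp add: orthonormal_def)
  then have d: "dim_vec (e i) = 2" for i
    by (simp add: carrier_vecD)
  have "tensor_vec (e i) (e j) \<in> carrier_vec 4" for i j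
    using tensor_vec_carrier [OF e e] by simp
  moreover have "tensor_vec (e (i div 2)) (e (i mod 2)) \<bullet>c tensor_vec (e (j div 2)) (e (j mod 2))
      = (if i = j then 1 else 0)" if "i < 4" "j < 4" for i j
  proof -
    have "i div 2 < 2" "j div 2 < 2" using that by auto
    then have "tensor_vec (e (i div 2)) (e (i mod 2)) \<bullet>c tensor_vec (e (j div 2)) (e (j mod 2))
        = (if i div 2 = j div 2 then 1 else 0) * (if i mod 2 = j mod 2 then 1 else 0)"
      using assms by (simp add: cscalar_prod_tensor d orthonormal_def)
    moreover have "i = j \<longleftrightarrow> i div 2 = j div 2 \<and> i mod 2 = j mod 2"
      by (metis div_mult_mod_eq)
    ultimately show ?thesis by simp
  qed
  ultimately show ?thesis
    by (simp add: orthonormal_def)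
qed

lemma mult_mat_vec_lincomb:
  fixes T :: "complex mat"
  assumes T: "T \<in> carrier_mat p q" and v: "dim_vec v = q" and i: "i < p"
    and t: "\<And>k. k < h \<Longrightarrow> dim_vec (t k) = q"
    and eq: "\<And>j. j < q \<Longrightarrow> v $ j = (\<Sum>k<h. c k * t k $ j)"
  shows "(T *\<^sub>v v) $ i = (\<Sum>k<h. c k * (T *\<^sub>v t k) $ i)"
proof -
  have "(T *\<^sub>v v) $ i = (\<Sum>j<q. \<Sum>k<h. c k * (T $$ (i, j) * t k $ j))"
    using T i v by (simp add: mult_mat_vec_index eq sum_distrib_left mult_ac del: index_mult_mat_vec)
  also have "\<dots> = (\<Sum>k<h. \<Sum>j<q. c k * (T $$ (i, j) * t k $ j))"
    by (rule sum.swap)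
  finally show ?thesis
    using T i t by (simp add: mult_mat_vec_index sum_distrib_left del: index_mult_mat_vec)
qed

text \<open>The rows \<open>0\<close> and \<open>2\<close> are nonzero since the encoded qubit is written to the first of
  the two qubits of a party and the second one is reset to \<open>|0\<rangle>\<close>.\<close>

definition parity_kraus :: "(nat \<Rightarrow> complex vec) \<Rightarrow> nat \<Rightarrow> complex mat" where
  "parity_kraus e i = mat 4 4 (\<lambda>(r, x).
     if r = 0 then (cnj (e 0 $ x) + (- 1) ^ i * cnj (e 3 $ x)) / complex_of_real (sqrt 2)
     else if r = 2 then (cnj (e 1 $ x) + (- 1) ^ i * cnj (e 2 $ x)) / complex_of_real (sqrt 2)
     else 0)"

lemma parity_kraus_carrier [simp]: "parity_kraus e i \<in> carrier_mat 4 4"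
  by (simp add: parity_kraus_def)

text \<open>The product of the two X operators exchanges \<open>e 0\<close> with \<open>e 3\<close>
  and \<open>e 1\<close> with \<open>e 2\<close>. The nonzero rows of operator \<open>i\<close> are
  its normalised eigenvectors for the eigenvalue \<open>(- 1) ^ i\<close>, and the four eigenvectors
  of both outcomes form a basis.\<close>

lemma parity_kraus_complete:
  assumes e: "orthonormal 4 e"
  shows "mat_sum 4 2 (\<lambda>i. mat_adjoint (parity_kraus e i) * parity_kraus e i) = 1\<^sub>m 4"
proof (rule eq_matI)
  fix x y
  assume "x < dim_row (1\<^sub>m 4 :: complex mat)" "y < dim_col (1\<^sub>m 4 :: complex mat)"
  then have xy: "x < 4" "y < 4" by auto
  have d: "dim_row (parity_kraus e i) = 4" "dim_col (parity_kraus e i) = 4" for i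
    by (simp_all add: parity_kraus_def)
  have "mat_sum 4 2 (\<lambda>i. mat_adjoint (parity_kraus e i) * parity_kraus e i) $$ (x, y)
      = (\<Sum>i<2. \<Sum>r<4. cnj (parity_kraus e i $$ (r, x)) * parity_kraus e i $$ (r, y))"
    using xy by (simp add: d mult_mat_index del: index_mult_mat(1))
  also have "\<dots> = (\<Sum>k<4. e k $ x * cnj (e k $ y))"
  proof -
    have q: "a / complex_of_real (sqrt 2) * (b / complex_of_real (sqrt 2)) = a * b / 2" for a b
      by (simp add: sqrt2_mult_sqrt2)
    \<comment> \<open>Summing over the two outcomes cancels the cross terms within each exchanged
      pair of basis vectors.\<close>
    have pm: "(a + b) * (c + d) / 2 + (a - b) * (c - d) / 2 = a * c + b * d" for a b c d :: complex
      by (simp add: algebra_simps add_divide_distrib diff_divide_distrib)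
    have comb: "p + r + (p' + r') = a + c + d + b" if "p + p' = a + b" "r + r' = c + d"
      for p r p' r' a b c d :: complex
    proof -
      have "p + r + (p' + r') = (p + p') + (r + r')" by (simp only: ac_simps)
      then show ?thesis unfolding that by (simp only: ac_simps)
    qed
    show ?thesis
      using xy unfolding sum_lessThan_2 sum_lessThan_4
      by (simp add: parity_kraus_def q del: times_divide_times_eq times_divide_eq_left times_divide_eq_right)
         (rule comb [OF pm pm])
  qed
  also have "\<dots> = 1\<^sub>m 4 $$ (x, y)"
    using xy by (simp add: orthonormal_complete [OF e])
  finally show "mat_sum 4 2 (\<lambda>i. mat_adjoint (parity_kraus e i) * parity_kraus e i) $$ (x, y)
      = 1\<^sub>m 4 $$ (x, y)" .
qed auto

lemma parity_kraus_apply: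
  assumes e: "orthonormal 4 e" and k: "k < 4"
  shows "parity_kraus e i *\<^sub>v e k = vec 4 (\<lambda>r.
     if r = 0 then (if k = 0 then 1 else if k = 3 then (- 1) ^ i else 0) / complex_of_real (sqrt 2)
     else if r = 2 then (if k = 1 then 1 else if k = 2 then (- 1) ^ i else 0) / complex_of_real (sqrt 2)
     else 0)" (is "_ = ?v")
proof (rule eq_vecI)
  fix r
  assume "r < dim_vec ?v"
  then have r: "r < 4" by simp
  have d: "dim_vec (e j) = 4" for j
    using e by (auto simp: orthonormal_def)
  have o: "(\<Sum>x<4. cnj (e j $ x) * e k $ x) = (if k = j then 1 else 0)" if "j < 4" for j
    using e k that by (simp add: orthonormal_def cscalar_prod_sum d mult.commute)
  have s: "(\<Sum>x<4. (cnj (e j $ x) + z * cnj (e l $ x)) / q * e k $ x)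
      = ((if k = j then 1 else 0) + z * (if k = l then 1 else 0)) / q"
    if "j < 4" "l < 4" for j l z q
    unfolding o [OF that(1), symmetric] o [OF that(2), symmetric]
    by (simp add: sum_distrib_left sum_divide_distrib sum.distrib algebra_simps add_divide_distrib)
  show "(parity_kraus e i *\<^sub>v e k) $ r = ?v $ r"
    using r s [of 0 3] s [of 1 2]
    by (simp add: mult_mat_vec_index parity_kraus_def d del: index_mult_mat_vec)
qed (simp add: parity_kraus_def)

text \<open>Both parties measure the product of the two local Pauli X operators, relative to
  their bases, and keep the pair if the outcomes agree. An error on exactly one of the pairs
  makes them disagree.\<close>

definition parity_protocol ::
    "(nat \<Rightarrow> complex vec) \<Rightarrow> (nat \<Rightarrow> complex vec) \<Rightarrow> complex mat \<Rightarrow> complex mat" where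
  "parity_protocol e f =
     (\<lambda>X. mat_sum (4 * 4) 2 (\<lambda>i.
        (\<lambda>Y. mat_sum (4 * 4) 2 (\<lambda>j. (if i = j then (\<lambda>Z. Z) else (\<lambda>Z. 0\<^sub>m (4 * 4) (4 * 4)))
           (tensor_mat (1\<^sub>m 4) (parity_kraus f j) * Y * mat_adjoint (tensor_mat (1\<^sub>m 4) (parity_kraus f j)))))
        (tensor_mat (parity_kraus e i) (1\<^sub>m 4) * X * mat_adjoint (tensor_mat (parity_kraus e i) (1\<^sub>m 4)))))"

lemma locc_parity_protocol:
  assumes "orthonormal 4 e" "orthonormal 4 f"
  shows "locc 4 4 4 4 (parity_protocol e f)"
proof -
  have "locc 4 4 4 4 (if i = j then (\<lambda>Z. Z) else (\<lambda>Z. 0\<^sub>m (4 * 4) (4 * 4)))" for i j :: nat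
    by (cases "i = j") (simp_all only: if_True if_False simp_thms locc.success locc.failure)
  then show ?thesis
    unfolding parity_protocol_def
    by (intro locc.alice [where d = "\<lambda>_. 4"] locc.bob [where d = "\<lambda>_. 4"]
        parity_kraus_carrier parity_kraus_complete assms)
qed

lemma parity_protocol_ketbra:
  fixes e f :: "nat \<Rightarrow> complex vec"
  assumes v: "v \<in> carrier_vec 16"
  defines "w \<equiv> \<lambda>i. tensor_mat (1\<^sub>m 4) (parity_kraus f i) *\<^sub>v (tensor_mat (parity_kraus e i) (1\<^sub>m 4) *\<^sub>v v)"
  shows "parity_protocol e f (ketbra v v) = mat_sum 16 2 (\<lambda>i. ketbra (w i) (w i))"
proof -
  let ?A = "\<lambda>i. tensor_mat (parity_kraus e i) (1\<^sub>m 4)"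
    and ?B = "\<lambda>i. tensor_mat (1\<^sub>m 4) (parity_kraus f i)"
  have A: "?A i \<in> carrier_mat 16 16" and B: "?B i \<in> carrier_mat 16 16" for i
    using tensor_mat_carrier [OF parity_kraus_carrier one_carrier_mat, of e i 4]
      tensor_mat_carrier [OF one_carrier_mat parity_kraus_carrier, of 4 f i] by simp_all
  have n: "4 * 4 = (16 :: nat)" by simp
  have Av: "?A i *\<^sub>v v \<in> carrier_vec 16" for i
    by (rule mult_mat_vec_carrier [OF A v])
  have w: "dim_vec (w i) = 16" for i
    unfolding w_def by (rule carrier_vecD [OF mult_mat_vec_carrier [OF B Av]])
  \<comment> \<open>Disagreeing outcomes contribute zero matrices, so Bob's sum collapses to Alice's
    outcome.\<close>
  have inner: "mat_sum 16 2 (\<lambda>j. (if i = j then (\<lambda>Z. Z) else (\<lambda>Z. 0\<^sub>m 16 16)) (M j)) = M i"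
    if "i < 2" "M i \<in> carrier_mat 16 16" for i and M :: "nat \<Rightarrow> complex mat"
  proof (rule eq_matI)
    fix x y
    assume "x < dim_row (M i)" "y < dim_col (M i)"
    then have xy: "x < 16" "y < 16" using that by auto
    have "mat_sum 16 2 (\<lambda>j. (if i = j then (\<lambda>Z. Z) else (\<lambda>Z. 0\<^sub>m 16 16)) (M j)) $$ (x, y)
        = (\<Sum>j<2. if i = j then M j $$ (x, y) else 0)"
      unfolding mat_sum_index [OF xy] using xy by (intro sum.cong refl) simp
    then show "mat_sum 16 2 (\<lambda>j. (if i = j then (\<lambda>Z. Z) else (\<lambda>Z. 0\<^sub>m 16 16)) (M j)) $$ (x, y)
        = M i $$ (x, y)"
      using that by simp
  qed (use that in auto)
  have "parity_protocol e f (ketbra v v)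
      = mat_sum 16 2 (\<lambda>i. mat_sum 16 2 (\<lambda>j. (if i = j then (\<lambda>Z. Z) else (\<lambda>Z. 0\<^sub>m 16 16))
          (ketbra (?B j *\<^sub>v (?A i *\<^sub>v v)) (?B j *\<^sub>v (?A i *\<^sub>v v)))))"
    unfolding parity_protocol_def mult_ketbra [OF A v] mult_ketbra [OF B Av] by (simp only: n)
  also have "\<dots> = mat_sum 16 2 (\<lambda>i. ketbra (w i) (w i))"
    unfolding w_def
    by (rule mat_sum_cong, rule inner)
       (auto intro!: ketbra_carrier mult_mat_vec_carrier [OF B Av])
  finally show ?thesis .
qed

text \<open>For indices below 4, \<open>fourier_sign s k / 2\<close> is the matrix entry of the
  Hadamard transform on two qubits.\<close>

definition fourier_sign :: "nat \<Rightarrow> nat \<Rightarrow> complex" where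
  "fourier_sign s k = (- 1) ^ ((s div 2) * (k div 2) + (s mod 2) * (k mod 2))"

text \<open>Positions 0 and 10 are |00> and |11> on the kept pair with both discarded qubits reset.
  No error leaves a multiple of Phi+, errors on both pairs leave the same with a relative minus
  sign, and for a single error the signs cancel at both positions.\<close>

lemma parity_measurement_vec:
  assumes e: "orthonormal 4 e" and f: "orthonormal 4 f" and v: "v \<in> carrier_vec 16"
    and eq: "\<And>x. x < 16 \<Longrightarrow> v $ x = (\<Sum>k<4. fourier_sign s k / 2 * tensor_vec (e k) (f k) $ x)"
    and s: "s < 4" and i: "i < 2" and x: "x < 16"
  shows "(tensor_mat (1\<^sub>m 4) (parity_kraus f i) *\<^sub>v (tensor_mat (parity_kraus e i) (1\<^sub>m 4) *\<^sub>v v)) $ x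
    = (if x = 0 then (if s = 0 \<or> s = 3 then 1 / 2 else 0)
       else if x = 10 then (if s = 0 then 1 / 2 else if s = 3 then - 1 / 2 else 0) else 0)"
proof -
  let ?A = "tensor_mat (parity_kraus e i) (1\<^sub>m 4)" and ?B = "tensor_mat (1\<^sub>m 4) (parity_kraus f i)"
  have A: "?A \<in> carrier_mat 16 16" and B: "?B \<in> carrier_mat 16 16"
    using tensor_mat_carrier [OF parity_kraus_carrier one_carrier_mat, of e i 4]
      tensor_mat_carrier [OF one_carrier_mat parity_kraus_carrier, of 4 f i] by simp_all
  have c: "e k \<in> carrier_vec 4" "f k \<in> carrier_vec 4" for k
    using e f by (auto simp: orthonormal_def)
  then have d: "dim_vec (e k) = 4" "dim_vec (f k) = 4" for k
    by (simp_all add: carrier_vecD)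
  have pe: "parity_kraus e i *\<^sub>v e k \<in> carrier_vec 4" for k
    by (rule mult_mat_vec_carrier [OF parity_kraus_carrier c(1)])
  have t: "?A *\<^sub>v tensor_vec (e k) (f k) = tensor_vec (parity_kraus e i *\<^sub>v e k) (f k)"
    "?B *\<^sub>v tensor_vec (parity_kraus e i *\<^sub>v e k) (f k)
       = tensor_vec (parity_kraus e i *\<^sub>v e k) (parity_kraus f i *\<^sub>v f k)" for k
    using tensor_mat_mult_vec [OF parity_kraus_carrier one_carrier_mat c(1,2)]
      tensor_mat_mult_vec [OF one_carrier_mat parity_kraus_carrier pe c(2)]
      one_mult_mat_vec [OF c(2)] one_mult_mat_vec [OF pe] by simp_all
  have "(?A *\<^sub>v v) $ y = (\<Sum>k<4. fourier_sign s k / 2 * (?A *\<^sub>v tensor_vec (e k) (f k)) $ y)"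
    if "y < 16" for y
    by (rule mult_mat_vec_lincomb [OF A carrier_vecD [OF v] that _ eq]) (simp_all add: d)
  then have "(?A *\<^sub>v v) $ y = (\<Sum>k<4. fourier_sign s k / 2 * tensor_vec (parity_kraus e i *\<^sub>v e k) (f k) $ y)"
    if "y < 16" for y
    unfolding t using that by blast
  then have "(?B *\<^sub>v (?A *\<^sub>v v)) $ x
      = (\<Sum>k<4. fourier_sign s k / 2 * (?B *\<^sub>v tensor_vec (parity_kraus e i *\<^sub>v e k) (f k)) $ x)"
    by (intro mult_mat_vec_lincomb [OF B _ x])
       (use A pe in \<open>simp_all add: d carrier_vecD parity_kraus_def\<close>)
  also have "\<dots> = (\<Sum>k<4. fourier_sign s k / 2
      * tensor_vec (parity_kraus e i *\<^sub>v e k) (parity_kraus f i *\<^sub>v f k) $ x)"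
    unfolding t ..
  finally have main: "(?B *\<^sub>v (?A *\<^sub>v v)) $ x = (\<Sum>k<4. fourier_sign s k / 2
      * tensor_vec (parity_kraus e i *\<^sub>v e k) (parity_kraus f i *\<^sub>v f k) $ x)" .
  \<comment> \<open>The sign of the outcome occurs once for Alice and once for Bob and squares to 1,
    so both agreeing outcomes leave the same vector. A common label \<open>k\<close> rules out
    positions at which the parties' kept qubits differ.\<close>
  have prod: "(parity_kraus e i *\<^sub>v e k) $ p * (parity_kraus f i *\<^sub>v f k) $ q
      = (if p = 0 \<and> q = 0 then (if k = 0 \<or> k = 3 then 1 / 2 else 0)
         else if p = 2 \<and> q = 2 then (if k = 1 \<or> k = 2 then 1 / 2 else 0) else 0)"
    if "k < 4" "p < 4" "q < 4" for k p q
  proof -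
    have sq: "(- 1) ^ i * (- 1) ^ i = (1 :: complex)"
      by (simp flip: power_add)
    show ?thesis
      unfolding parity_kraus_apply [OF e that(1)] parity_kraus_apply [OF f that(1)]
      using that(2,3) by (simp add: sq sqrt2_mult_sqrt2)
  qed
  have xy: "x div 4 < 4" "x mod 4 < 4" using x by auto
  have "tensor_vec (parity_kraus e i *\<^sub>v e k) (parity_kraus f i *\<^sub>v f k) $ x
      = (parity_kraus e i *\<^sub>v e k) $ (x div 4) * (parity_kraus f i *\<^sub>v f k) $ (x mod 4)" for k
    using x by (simp add: parity_kraus_def del: index_mult_mat_vec)
  then have "(?B *\<^sub>v (?A *\<^sub>v v)) $ x
      = (if x div 4 = 0 \<and> x mod 4 = 0 then (fourier_sign s 0 + fourier_sign s 3) / 4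
         else if x div 4 = 2 \<and> x mod 4 = 2 then (fourier_sign s 1 + fourier_sign s 2) / 4 else 0)"
    unfolding main sum_lessThan_4 by (simp add: prod xy del: index_mult_mat_vec)
  moreover have "x div 4 = 0 \<and> x mod 4 = 0 \<longleftrightarrow> x = 0" "x div 4 = 2 \<and> x mod 4 = 2 \<longleftrightarrow> x = 10"
    by presburger+
  moreover have "s = 0 \<or> s = 1 \<or> s = 2 \<or> s = 3" using s by auto
  ultimately show ?thesis
    by (elim disjE) (simp_all add: fourier_sign_def)
qed

section \<open>Optimality\<close>

definition superpose :: "(nat \<Rightarrow> complex vec) \<Rightarrow> nat \<Rightarrow> complex vec" where
  "superpose g i = vec 4 (\<lambda>x. (g 0 $ x + (- 1) ^ i * g 1 $ x) / complex_of_real (sqrt 2))"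

lemma superpose_carrier [simp]: "superpose g i \<in> carrier_vec 4"
  by (simp add: superpose_def)

lemma superpose_dim [simp]: "dim_vec (superpose g i) = 4"
  by (simp add: superpose_def)

lemma superpose_prod:
  assumes "x < 4" "y < 4"
  shows "superpose g i $ x * cnj (superpose g j $ y)
    = (g 0 $ x + (- 1) ^ i * g 1 $ x) * (cnj (g 0 $ y) + (- 1) ^ j * cnj (g 1 $ y)) / 2"
  using assms sqrt2_mult_sqrt2 by (simp add: superpose_def)

text \<open>The Hadamard transform is unitary: in the sum of the two rank-one terms the cross terms
  cancel.\<close>

lemma mixture_superpose:
  assumes "\<And>i. g i \<in> carrier_vec 4"
  shows "mixture (\<lambda>_. 1) (superpose g) = mixture (\<lambda>_. 1) g"
proof (rule eq_matI)
  fix x y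
  assume "x < dim_row (mixture (\<lambda>_. 1) g)" "y < dim_col (mixture (\<lambda>_. 1) g)"
  then have xy: "x < 4" "y < 4" by (auto simp: mixture_def)
  show "mixture (\<lambda>_. 1) (superpose g) $$ (x, y) = mixture (\<lambda>_. 1) g $$ (x, y)"
    unfolding mixture_index [OF superpose_carrier xy] mixture_index [OF assms xy]
      superpose_prod [OF xy] sum_lessThan_2
    by (simp add: algebra_simps add_divide_distrib diff_divide_distrib)
qed (simp_all add: mixture_def)

section \<open>Product bases and the given state\<close>

definition tensor_family :: "(nat \<Rightarrow> complex vec) \<Rightarrow> (nat \<Rightarrow> complex vec) \<Rightarrow> nat \<Rightarrow> complex vec" where
  "tensor_family e f i = tensor_vec (e i) (f i)"

definition two_copies :: "(nat \<Rightarrow> complex vec) \<Rightarrow> nat \<Rightarrow> complex vec" where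
  "two_copies e k = tensor_vec (e (k div 2)) (e (k mod 2))"

lemma tensor_family_carrier:
  assumes "orthonormal 2 e" "orthonormal 2 f"
  shows "tensor_family e f i \<in> carrier_vec 4"
  using assms tensor_vec_carrier [of "e i" 2 "f i" 2] by (simp add: tensor_family_def orthonormal_def)

lemma joint_vec_tensor_family:
  assumes "orthonormal 2 e" "orthonormal 2 f"
  shows "joint_vec (tensor_family e f) k = tensor_vec (two_copies e k) (two_copies f k)"
  using assms unfolding joint_vec_def tensor_family_def two_copies_def
  by (intro swap_vec_tensor) (auto simp: orthonormal_def)

text \<open>Expanding both copies at once multiplies two Hadamard transforms, which gives the signs
  of \<open>fourier_sign\<close> and the factor (1 / sqrt 2)^2 = 1 / 2.\<close>

lemma joint_vec_superpose:
  assumes g: "\<And>i. g i \<in> carrier_vec 4" and s: "s < 4" and x: "x < 16"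
  shows "joint_vec (superpose g) s $ x = (\<Sum>k<4. fourier_sign s k / 2 * joint_vec g k $ x)"
proof -
  have d: "dim_vec (g i) = 4" for i
    using g [of i] by simp
  define y where "y = swap23_index x"
  have y: "y < 16" "y div 4 < 4" "y mod 4 < 4"
    using swap23_index_less [OF x] by (auto simp: y_def)
  have l: "joint_vec (superpose g) s $ x
      = (g 0 $ (y div 4) + (- 1) ^ (s div 2) * g 1 $ (y div 4))
        * (g 0 $ (y mod 4) + (- 1) ^ (s mod 2) * g 1 $ (y mod 4)) / 2"
    using x y sqrt2_mult_sqrt2 by (simp add: joint_vec_def superpose_def flip: y_def)
  have r: "joint_vec g k $ x = g (k div 2) $ (y div 4) * g (k mod 2) $ (y mod 4)" for k
    using x y by (simp add: joint_vec_def d flip: y_def)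
  show ?thesis
    unfolding l r sum_lessThan_4
    by (simp add: fourier_sign_def power_add algebra_simps add_divide_distrib)
qed

text \<open>The even and the odd superposition have equal diagonal terms and opposite cross terms,
  so weights with sum 1 and difference \<open>cmod R\<close> reproduce both parts of the state. A
  phase on Alice's second basis vector does not affect orthonormality.\<close>

lemma S_state_mixture:
  assumes a: "qubit_onb a a'" and b: "qubit_onb b b'" and R: "R \<noteq> 0"
  obtains e f where "orthonormal 2 e" "orthonormal 2 f"
    "S_state a a' b b' \<alpha> R
       = mixture (\<lambda>i. complex_of_real (if i = 0 then (1 + cmod R) / 2 else 1 - (1 + cmod R) / 2))
           (superpose (tensor_family e f))"
proof -
  \<comment> \<open>The phase of the entire coherence, so that \<open>\<alpha>\<close> and the
    argument of \<open>R\<close> are absorbed together.\<close>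
  define u where "u = exp (\<i> * complex_of_real \<alpha>) * (R / complex_of_real (cmod R))"
  have "cmod u = 1"
    using R by (simp add: u_def norm_mult norm_divide)
  then have u1: "u * cnj u = 1"
    using complex_norm_square [of u] by simp
  have uR: "exp (\<i> * complex_of_real \<alpha>) * R = complex_of_real (cmod R) * u"
    using R by (simp add: u_def)
  have uR': "exp (- \<i> * complex_of_real \<alpha>) * cnj R = complex_of_real (cmod R) * cnj u"
  proof -
    have "exp (- \<i> * complex_of_real \<alpha>) * cnj R = cnj (exp (\<i> * complex_of_real \<alpha>) * R)"
      using cis_cnj [of \<alpha>] by (simp add: cis_conv_exp)
    then show ?thesis unfolding uR by simp
  qed
  have swap: "y \<bullet>c x = cnj (x \<bullet>c y)" if "dim_vec x = dim_vec y" for x y :: "complex vec"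
    using that by (simp add: cscalar_prod_sum mult.commute)
  define e where "e i = (if i = 0 then a else u \<cdot>\<^sub>v a')" for i :: nat
  define f where "f i = (if i = 0 then b else b')" for i :: nat
  have d: "dim_vec a = 2" "dim_vec a' = 2" "dim_vec b = 2" "dim_vec b' = 2"
    using a b by (auto simp: qubit_onb_def)
  have less_2: "i < 2 \<longleftrightarrow> i = 0 \<or> i = 1" for i :: nat by auto
  have sc: "(u \<cdot>\<^sub>v a') \<bullet>c (u \<cdot>\<^sub>v a') = u * cnj u * (a' \<bullet>c a')" "a \<bullet>c (u \<cdot>\<^sub>v a') = cnj u * (a \<bullet>c a')"
    by (simp_all add: cscalar_prod_sum d sum_distrib_left mult_ac)
  have e: "orthonormal 2 e"
    using a swap [of a "u \<cdot>\<^sub>v a'"]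
    by (auto simp: orthonormal_def e_def less_2 qubit_onb_def sc u1 d)
  have f: "orthonormal 2 f"
    using b swap [of b b'] by (auto simp: orthonormal_def f_def less_2 qubit_onb_def d)
  let ?w = "\<lambda>i::nat. complex_of_real (if i = 0 then (1 + cmod R) / 2 else 1 - (1 + cmod R) / 2)"
  let ?g = "tensor_family e f"
  have "S_state a a' b b' \<alpha> R = mixture ?w (superpose ?g)" (is "?l = ?r")
  proof (rule eq_matI)
    fix x y
    assume "x < dim_row ?r" "y < dim_col ?r"
    then have xy: "x < 4" "y < 4" by (auto simp: mixture_def)
    define p where "p = tensor_vec a b $ x"
    define q where "q = tensor_vec a' b' $ x"
    define p' where "p' = cnj (tensor_vec a b $ y)"
    define q' where "q' = cnj (tensor_vec a' b' $ y)"
    have g: "?g 0 $ x = p" "?g 1 $ x = u * q" "cnj (?g 0 $ y) = p'" "cnj (?g 1 $ y) = cnj u * q'"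
      using xy div_mod_less [of x 2 2] div_mod_less [of y 2 2]
      by (simp_all add: tensor_family_def e_def f_def p_def q_def p'_def q'_def d)
    have uu: "u * (cnj u * z) = z" for z
      unfolding mult.assoc [symmetric] u1 by simp
    have "?l $$ (x, y) = (p * p' + complex_of_real (cmod R) * cnj u * (p * q')
        + complex_of_real (cmod R) * u * (q * p') + q * q') / 2"
      unfolding S_state_def Let_def uR uR'
      using xy by (simp add: d p_def q_def p'_def q'_def)
    also have "\<dots> = ?r $$ (x, y)"
      unfolding mixture_index [OF superpose_carrier xy] superpose_prod [OF xy] sum_lessThan_2 g
      by (simp add: algebra_simps add_divide_distrib diff_divide_distrib uu u1)
    finally show "?l $$ (x, y) = ?r $$ (x, y)" .
  qed (simp_all add: mixture_def S_state_def Let_def d)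
  with e f show ?thesis by (rule that)
qed

lemma superpose_norm:
  assumes "orthonormal 2 e" "orthonormal 2 f"
  shows "superpose (tensor_family e f) 0 \<bullet>c superpose (tensor_family e f) 0 = 1"
proof -
  let ?g = "tensor_family e f"
  have d: "dim_vec (e i) = 2" "dim_vec (f i) = 2" for i
    using assms by (auto simp: orthonormal_def)
  have g: "(\<Sum>x<4. ?g i $ x * cnj (?g j $ x)) = (if i = j then 1 else 0)" if "i < 2" "j < 2" for i j
    using cscalar_prod_tensor [of "e i" "e j" "f i" "f j"] assms that
    by (simp add: d tensor_family_def cscalar_prod_sum [of "tensor_vec (e i) (f i)"] orthonormal_def
        split: if_splits)
  have "superpose ?g 0 \<bullet>c superpose ?g 0
      = (\<Sum>x<4. (?g 0 $ x + ?g 1 $ x) * (cnj (?g 0 $ x) + cnj (?g 1 $ x)) / 2)"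
    unfolding cscalar_prod_sum superpose_dim by (rule sum.cong) (simp_all add: superpose_prod)
  also have "\<dots> = ((\<Sum>x<4. ?g 0 $ x * cnj (?g 0 $ x)) + (\<Sum>x<4. ?g 0 $ x * cnj (?g 1 $ x))
      + (\<Sum>x<4. ?g 1 $ x * cnj (?g 0 $ x)) + (\<Sum>x<4. ?g 1 $ x * cnj (?g 1 $ x))) / 2"
    by (simp add: algebra_simps sum.distrib flip: sum_divide_distrib)
  also have "\<dots> = 1"
    using g [of 0 0] g [of 0 1] g [of 1 0] g [of 1 1] by simp
  finally show ?thesis .
qed

text \<open>With the trace bound of \<open>locc_ketbra_bounds\<close> this gives the premise
  \<open>\<tau> 0 \<le> 1\<close> of \<open>optimal_tradeoff\<close>, which caps the success
  probability.\<close>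

lemma joint_vec_superpose_norm:
  assumes "orthonormal 2 e" "orthonormal 2 f"
  shows "joint_vec (superpose (tensor_family e f)) 0 \<bullet>c joint_vec (superpose (tensor_family e f)) 0 = 1"
proof -
  let ?h = "superpose (tensor_family e f)"
  have "tensor_vec (?h 0) (?h 0) \<in> carrier_vec 16"
    using tensor_vec_carrier [OF superpose_carrier superpose_carrier] by simp
  then show ?thesis
    by (simp add: joint_vec_def norm_swap_vec cscalar_prod_tensor superpose_norm [OF assms])
qed

text \<open>The four error states and the four product states \<open>|kk\<rangle>\<close> have the same uniform
  mixture; on the latter the overlap is at most half the trace.\<close>

lemma locc_superpose_half:
  assumes L: "locc 4 4 4 4 L" and e: "orthonormal 2 e" and f: "orthonormal 2 f"
  defines "X \<equiv> \<lambda>s. ketbra (joint_vec (superpose (tensor_family e f)) s)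
      (joint_vec (superpose (tensor_family e f)) s)"
  shows "2 * (\<Sum>s<4. Re (kept_overlap (L (X s)))) \<le> (\<Sum>s<4. Re (mat_trace (L (X s))))"
proof -
  let ?g = "tensor_family e f"
  define Y where "Y k = ketbra (joint_vec ?g k) (joint_vec ?g k)" for k
  note g = tensor_family_carrier [OF e f]
  \<comment> \<open>Both sides are the reordered double copy of one projector, expanded in the
    superposed and in the product basis of its range.\<close>
  have sum_eq: "mat_sum (4 * 4) 4 (\<lambda>s. 1 \<cdot>\<^sub>m X s) = mat_sum (4 * 4) 4 (\<lambda>k. 1 \<cdot>\<^sub>m Y k)"
    using swap23_joint_state [where f = "superpose ?g" and c = "\<lambda>_. 1", OF superpose_carrier]
    unfolding mixture_superpose [OF g] swap23_joint_state [OF g] X_def Y_def by simp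
  have X: "X s \<in> carrier_mat (4 * 4) (4 * 4)" and Y: "Y s \<in> carrier_mat (4 * 4) (4 * 4)" for s
    by (simp_all add: X_def Y_def)
  have LX: "L (X s) \<in> carrier_mat 16 16" and LY: "L (Y s) \<in> carrier_mat 16 16" for s
    using locc_carrier [OF L X] locc_carrier [OF L Y] by simp_all
  have eq: "mat_sum 16 4 (\<lambda>s. 1 \<cdot>\<^sub>m L (X s)) = mat_sum 16 4 (\<lambda>k. 1 \<cdot>\<^sub>m L (Y k))"
    using locc_mat_sum [where X = X and h = 4 and c = "\<lambda>_. 1", OF L X]
      locc_mat_sum [where X = Y and h = 4 and c = "\<lambda>_. 1", OF L Y]
    unfolding sum_eq by simp
  have tr: "mat_trace (mat_sum 16 4 (\<lambda>s. 1 \<cdot>\<^sub>m M s)) = (\<Sum>s<4. mat_trace (M s))"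
    and ov: "kept_overlap (mat_sum 16 4 (\<lambda>s. 1 \<cdot>\<^sub>m M s)) = (\<Sum>s<4. kept_overlap (M s))"
    if M: "\<And>s. M s \<in> carrier_mat 16 16" for M
    using mat_trace_mat_sum [of 4 "\<lambda>s. 1 \<cdot>\<^sub>m M s" 16] M
    by (simp_all add: kept_overlap_mat_sum mat_trace_smult [OF M] kept_overlap_smult [OF M])
  have c: "two_copies e k \<in> carrier_vec 4" "two_copies f k \<in> carrier_vec 4" for k
    using orthonormal_tensor [OF e] orthonormal_tensor [OF f]
    by (auto simp: orthonormal_def two_copies_def)
  have "2 * (\<Sum>k<4. Re (kept_overlap (L (Y k)))) \<le> (\<Sum>k<4. Re (mat_trace (L (Y k))))"
    unfolding sum_distrib_left Y_def joint_vec_tensor_family [OF e f]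
    by (intro sum_mono locc_product_bound [OF L] c)
  then show ?thesis
    using tr [of "\<lambda>s. L (X s)", OF LX] tr [of "\<lambda>s. L (Y s)", OF LY]
      ov [of "\<lambda>s. L (X s)", OF LX] ov [of "\<lambda>s. L (Y s)", OF LY]
    unfolding eq by (simp flip: Re_sum)
qed

section \<open>Upper bounds and their attainment\<close>

lemma locc_tradeoff:
  assumes L: "locc 4 4 4 4 L" and e: "orthonormal 2 e" and f: "orthonormal 2 f"
    and F: "1 / 2 < F" "F \<le> 1"
  defines "D \<equiv> \<lambda>X. swap23 (L (swap23 X))"
    and "\<rho> \<equiv> mixture (\<lambda>i. complex_of_real (if i = 0 then F else 1 - F)) (superpose (tensor_family e f))"
  assumes nz: "success_prob D \<rho> \<noteq> 0"
  shows "fidelity D \<rho> \<le> F\<^sup>2 / (F\<^sup>2 + (1 - F)\<^sup>2)"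
    and "fidelity D \<rho> = F\<^sup>2 / (F\<^sup>2 + (1 - F)\<^sup>2) \<Longrightarrow> success_prob D \<rho> \<le> F\<^sup>2 + (1 - F)\<^sup>2"
proof -
  let ?h = "superpose (tensor_family e f)"
  define \<tau> where "\<tau> s = Re (mat_trace (L (ketbra (joint_vec ?h s) (joint_vec ?h s))))" for s
  define \<phi> where "\<phi> s = Re (kept_overlap (L (ketbra (joint_vec ?h s) (joint_vec ?h s))))" for s
  define q where "q = F\<^sup>2 * \<phi> 0 + F * (1 - F) * (\<phi> 1 + \<phi> 2) + (1 - F)\<^sup>2 * \<phi> 3"
  note J = locc_joint_state [OF L, of ?h "\<lambda>i. if i = 0 then F else 1 - F", OF superpose_carrier]
  have p: "success_prob D \<rho> = F\<^sup>2 * \<tau> 0 + F * (1 - F) * (\<tau> 1 + \<tau> 2) + (1 - F)\<^sup>2 * \<tau> 3"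
    using J(1) unfolding D_def \<rho>_def \<tau>_def sum_lessThan_4
    by (simp add: power2_eq_square distrib_left mult_ac)
  have fid: "fidelity D \<rho> = q / success_prob D \<rho>"
    using J(2) unfolding D_def \<rho>_def \<phi>_def q_def sum_lessThan_4
    by (simp add: power2_eq_square distrib_left mult_ac)
  have bounds: "0 \<le> \<phi> s" "\<phi> s \<le> \<tau> s" "\<tau> 0 \<le> 1" for s
    using locc_ketbra_bounds [OF L, of "joint_vec ?h s"] locc_ketbra_bounds [OF L, of "joint_vec ?h 0"]
      joint_vec_superpose_norm [OF e f]
    by (simp_all add: \<tau>_def \<phi>_def)
  have half: "2 * (\<phi> 0 + \<phi> 1 + \<phi> 2 + \<phi> 3) \<le> \<tau> 0 + \<tau> 1 + \<tau> 2 + \<tau> 3"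
    using locc_superpose_half [OF L e f] unfolding sum_lessThan_4 \<tau>_def \<phi>_def .
  have T: "q * (F\<^sup>2 + (1 - F)\<^sup>2) \<le> F\<^sup>2 * success_prob D \<rho>"
    "q * (F\<^sup>2 + (1 - F)\<^sup>2) = F\<^sup>2 * success_prob D \<rho> \<Longrightarrow> success_prob D \<rho> \<le> F\<^sup>2 + (1 - F)\<^sup>2"
    by (rule optimal_tradeoff [OF F bounds half p q_def])
       (rule optimal_tradeoff(2) [OF F bounds half p q_def])
  have "0 \<le> \<tau> s" for s
    using bounds(1,2) [of s] by linarith
  then have "0 \<le> success_prob D \<rho>"
    unfolding p using F by (intro add_nonneg_nonneg mult_nonneg_nonneg) auto
  \<comment> \<open>Being a sum of nonnegative terms, a nonzero success probability is positive, so
    the cleared inequality can be divided by it.\<close>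
  with nz have pos: "0 < success_prob D \<rho>" by simp
  have M: "0 < F\<^sup>2 + (1 - F)\<^sup>2"
    using F by (intro add_pos_nonneg) auto
  show "fidelity D \<rho> \<le> F\<^sup>2 / (F\<^sup>2 + (1 - F)\<^sup>2)"
    unfolding fid using T(1) pos M by (simp add: field_simps)
  assume "fidelity D \<rho> = F\<^sup>2 / (F\<^sup>2 + (1 - F)\<^sup>2)"
  then show "success_prob D \<rho> \<le> F\<^sup>2 + (1 - F)\<^sup>2"
    unfolding fid using T(2) pos M by (simp add: frac_eq_eq mult.commute)
qed

text \<open>Each of the two agreeing outcomes contributes one half. Errors on both pairs cancel in
  the parity and pass unnoticed, with a kept pair orthogonal to Phi+; this is the term (1 - F)^2 in
  the success probability.\<close>

lemma parity_protocol_values: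
  assumes e: "orthonormal 2 e" and f: "orthonormal 2 f" and s: "s < 4"
  defines "v \<equiv> joint_vec (superpose (tensor_family e f)) s"
  defines "Z \<equiv> parity_protocol (two_copies e) (two_copies f) (ketbra v v)"
  shows "Re (mat_trace Z) = (if s = 0 \<or> s = 3 then 1 else 0)"
    and "Re (kept_overlap Z) = (if s = 0 then 1 else 0)"
proof -
  define w where "w i = tensor_mat (1\<^sub>m 4) (parity_kraus (two_copies f) i) *\<^sub>v
    (tensor_mat (parity_kraus (two_copies e) i) (1\<^sub>m 4) *\<^sub>v v)" for i
  have e4: "orthonormal 4 (two_copies e)" and f4: "orthonormal 4 (two_copies f)"
    unfolding two_copies_def by (rule orthonormal_tensor [OF e], rule orthonormal_tensor [OF f])
  have v: "v \<in> carrier_vec 16" by (simp add: v_def)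
  have eq: "v $ x = (\<Sum>k<4. fourier_sign s k / 2 * tensor_vec (two_copies e k) (two_copies f k) $ x)"
    if "x < 16" for x
    unfolding v_def joint_vec_superpose [OF tensor_family_carrier [OF e f] s that]
      joint_vec_tensor_family [OF e f] ..
  have "tensor_mat (parity_kraus (two_copies e) i) (1\<^sub>m 4) \<in> carrier_mat 16 16"
    "tensor_mat (1\<^sub>m 4) (parity_kraus (two_copies f) i) \<in> carrier_mat 16 16" for i
    using tensor_mat_carrier [OF parity_kraus_carrier one_carrier_mat, of "two_copies e" i 4]
      tensor_mat_carrier [OF one_carrier_mat parity_kraus_carrier, of 4 "two_copies f" i] by simp_all
  then have wd: "w i \<in> carrier_vec 16" for i
    unfolding w_def using v by (intro mult_mat_vec_carrier)
  have w_index: "w i $ x = (if x = 0 then (if s = 0 \<or> s = 3 then 1 / 2 else 0)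
       else if x = 10 then (if s = 0 then 1 / 2 else if s = 3 then - 1 / 2 else 0) else 0)"
    if "i < 2" "x < 16" for i x
    unfolding w_def by (rule parity_measurement_vec [OF e4 f4 v eq s that])
  have Z: "Z = mat_sum 16 2 (\<lambda>i. ketbra (w i) (w i))"
    unfolding Z_def w_def by (rule parity_protocol_ketbra [OF v])
  have "mat_trace (ketbra (w i) (w i)) = (if s = 0 \<or> s = 3 then 1 / 2 else 0)" if "i < 2" for i
    unfolding mat_trace_ketbra cscalar_prod_sum carrier_vecD [OF wd] sum_lessThan_16
    by (simp add: w_index [OF that])
  moreover have "mat_trace Z = (\<Sum>i<2. mat_trace (ketbra (w i) (w i)))"
    unfolding Z by (rule mat_trace_mat_sum) (rule ketbra_carrier [OF wd wd])
  ultimately show "Re (mat_trace Z) = (if s = 0 \<or> s = 3 then 1 else 0)"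
    unfolding sum_lessThan_2 by simp
  have "kept_overlap (ketbra (w i) (w i)) = (if s = 0 then 1 / 2 else 0)" if "i < 2" for i
    unfolding kept_overlap_ketbra [OF wd]
    by (simp add: w_index [OF that])
  then show "Re (kept_overlap Z) = (if s = 0 then 1 else 0)"
    unfolding Z kept_overlap_mat_sum sum_lessThan_2 by simp
qed

lemma parity_protocol_optimal:
  fixes F :: real
  assumes e: "orthonormal 2 e" and f: "orthonormal 2 f"
  defines "D \<equiv> \<lambda>X. swap23 (parity_protocol (two_copies e) (two_copies f) (swap23 X))"
    and "\<rho> \<equiv> mixture (\<lambda>i. complex_of_real (if i = 0 then F else 1 - F)) (superpose (tensor_family e f))"
  shows "D \<in> distillation_ops" "success_prob D \<rho> = F\<^sup>2 + (1 - F)\<^sup>2"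
    "fidelity D \<rho> = F\<^sup>2 / (F\<^sup>2 + (1 - F)\<^sup>2)"
proof -
  have L: "locc 4 4 4 4 (parity_protocol (two_copies e) (two_copies f))"
    unfolding two_copies_def
    by (rule locc_parity_protocol [OF orthonormal_tensor [OF e] orthonormal_tensor [OF f]])
  then show "D \<in> distillation_ops"
    unfolding D_def distillation_ops_def by blast
  note J = locc_joint_state [OF L, of "superpose (tensor_family e f)" "\<lambda>i. if i = 0 then F else 1 - F",
      OF superpose_carrier]
  show p: "success_prob D \<rho> = F\<^sup>2 + (1 - F)\<^sup>2"
    using J(1) unfolding D_def \<rho>_def sum_lessThan_4
    by (simp add: parity_protocol_values [OF e f] power2_eq_square)
  show "fidelity D \<rho> = F\<^sup>2 / (F\<^sup>2 + (1 - F)\<^sup>2)"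
    using J(2) unfolding p [unfolded D_def \<rho>_def] unfolding D_def \<rho>_def sum_lessThan_4
    by (simp add: parity_protocol_values [OF e f] power2_eq_square)
qed

theorem theorem2:
  fixes \<rho> :: "complex mat" and a a' b b' :: "complex vec"
    and \<alpha> F :: real and R :: complex
  assumes "density_matrix 4 \<rho>"
    and "qubit_onb a a'" and "qubit_onb b b'"
    and "0 \<le> \<alpha>" and "\<alpha> < 2 * pi"
    and "cmod R \<le> 1"
    and "\<rho> = S_state a a' b b' \<alpha> R"
    and "cmod R > 0"
    and "F = (1 / 2) * (1 + cmod R)"
  shows "is_maximum (achievable_fidelities \<rho>) (opt_fidelity \<rho>)
    \<and> is_maximum (opt_success_probs \<rho>) (opt_success_prob \<rho>)
    \<and> opt_success_prob \<rho> = F\<^sup>2 + (1 - F)\<^sup>2"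
proof -
  have F: "1 / 2 < F" "F \<le> 1" and F': "F = (1 + cmod R) / 2"
    using assms(6,8,9) by auto
  have "R \<noteq> 0" using assms(8) by auto
  then obtain e f where e: "orthonormal 2 e" and f: "orthonormal 2 f"
    and \<rho>: "\<rho> = mixture (\<lambda>i. complex_of_real (if i = 0 then F else 1 - F)) (superpose (tensor_family e f))"
    using S_state_mixture [OF assms(2,3)] unfolding assms(7) F' by metis
  define M where "M = F\<^sup>2 + (1 - F)\<^sup>2"
  have M: "M > 0"
    unfolding M_def using F by (intro add_pos_nonneg) auto
  obtain D\<^sub>0 where D\<^sub>0: "D\<^sub>0 \<in> distillation_ops" "success_prob D\<^sub>0 \<rho> = M" "fidelity D\<^sub>0 \<rho> = F\<^sup>2 / M"
    using parity_protocol_optimal(1) [OF e f] parity_protocol_optimal(2,3) [OF e f, of F]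
    unfolding \<rho> M_def by blast
  have upper: "fidelity D \<rho> \<le> F\<^sup>2 / M" "fidelity D \<rho> = F\<^sup>2 / M \<Longrightarrow> success_prob D \<rho> \<le> M"
    if D_op: "D \<in> distillation_ops" and nz: "success_prob D \<rho> \<noteq> 0" for D
  proof -
    obtain L where L: "locc 4 4 4 4 L" and D: "D = (\<lambda>X. swap23 (L (swap23 X)))"
      using D_op unfolding distillation_ops_def by blast
    show "fidelity D \<rho> \<le> F\<^sup>2 / M" "fidelity D \<rho> = F\<^sup>2 / M \<Longrightarrow> success_prob D \<rho> \<le> M"
      using locc_tradeoff [OF L e f F nz [unfolded D \<rho>]] unfolding D \<rho> M_def by simp_all
  qed
  \<comment> \<open>\<open>GREATEST\<close> is evaluated from membership and an upper bound. The
    fidelity comes first because its optimal value occurs in the definition of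
    \<open>opt_success_probs\<close>.\<close>
  have max_fid: "F\<^sup>2 / M \<in> achievable_fidelities \<rho>" "\<And>y. y \<in> achievable_fidelities \<rho> \<Longrightarrow> y \<le> F\<^sup>2 / M"
    using D\<^sub>0 M upper(1) unfolding achievable_fidelities_def by (force, blast)
  then have opt: "opt_fidelity \<rho> = F\<^sup>2 / M"
    unfolding opt_fidelity_def by (intro Greatest_equality)
  have max_prob: "M \<in> opt_success_probs \<rho>" "\<And>y. y \<in> opt_success_probs \<rho> \<Longrightarrow> y \<le> M"
    using D\<^sub>0 M upper(2) unfolding opt_success_probs_def opt by (force, blast)
  then have "opt_success_prob \<rho> = M"
    unfolding opt_success_prob_def by (intro Greatest_equality)
  with opt max_fid max_prob show ?thesis
    by (simp add: is_maximum_def M_def)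
qed

end
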